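(* Let $1\le q\le 3$ and $p_c=p_c(q)=\sqrt q/(1+\sqrt q)$. Then $$\sum_{x\in \mathbb Z^2}\phi^0_{\mathbb Z^2,p_c,q}(0\longleftrightarrow x)~=~\infty.$$
   Context: FK percolation: for a finite subgraph $G$ of $\mathbb Z^2$, a configuration $\omega$ is a subset of the edges of $G$ (the open edges). Boundary conditions $\xi$ are a partition of the boundary vertices of $G$; $k(\omega,\xi)$ is the number of connected components of the graph obtained from $\omega$ by wiring vertices in the same class of $\xi$. The FK measure is $\phi^\xi_{G,p,q}(\omega)\propto p^{o(\omega)}(1-p)^{c(\omega)}q^{k(\omega,\xi)}$ with $o(\omega)$, $c(\omega)$ the numbers of open and closed edges. Free boundary conditions ($\phi^0$) means no wiring. For $q\ge1$, $\phi^0_{\mathbb Z^2,p,q}$ is the infinite-volume measure obtained as the increasing limit of $\phi^0_{[-n,n]^2,p,q}$ as $n\to\infty$. $0\longleftrightarrow x$ means $0$ and $x$ are joined by a path of open edges. *)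

theory Defs
  imports "HOL-Analysis.Analysis"
begin

type_synonym vert = "int \<times> int"

definition box :: "nat \<Rightarrow> vert set" where
  "box n = {- int n .. int n} \<times> {- int n .. int n}"

definition adjacent :: "vert \<Rightarrow> vert \<Rightarrow> bool" where
  "adjacent u v \<longleftrightarrow> \<bar>fst u - fst v\<bar> + \<bar>snd u - snd v\<bar> = 1"

definition box_edges :: "nat \<Rightarrow> vert set set" where
  "box_edges n = {{u, v} | u v. u \<in> box n \<and> v \<in> box n \<and> adjacent u v}"

definition open_rel :: "vert set set \<Rightarrow> (vert \<times> vert) set" where
  "open_rel \<omega> = {(u, v). {u, v} \<in> \<omega>}"

definition connects :: "vert set set \<Rightarrow> vert \<Rightarrow> vert \<Rightarrow> bool" where
  "connects \<omega> x y \<longleftrightarrow> (x, y) \<in> (open_rel \<omega>)\<^sup>*"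

text \<open>Number of connected components (free boundary: no wiring) of (box n, omega).\<close>
definition num_clusters :: "nat \<Rightarrow> vert set set \<Rightarrow> nat" where
  "num_clusters n \<omega> =
     card (box n // {(x, y). x \<in> box n \<and> y \<in> box n \<and> connects \<omega> x y})"

definition fk_weight :: "nat \<Rightarrow> real \<Rightarrow> real \<Rightarrow> vert set set \<Rightarrow> real" where
  "fk_weight n p q \<omega> =
     p ^ card \<omega> * (1 - p) ^ (card (box_edges n) - card \<omega>) * q ^ num_clusters n \<omega>"

definition fk_free_prob :: "nat \<Rightarrow> real \<Rightarrow> real \<Rightarrow> (vert set set \<Rightarrow> bool) \<Rightarrow> real" where
  "fk_free_prob n p q A =
     (\<Sum>\<omega> \<in> {\<omega>. \<omega> \<subseteq> box_edges n \<and> A \<omega>}. fk_weight n p q \<omega>) /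
     (\<Sum>\<omega> \<in> Pow (box_edges n). fk_weight n p q \<omega>)"

text \<open>Infinite-volume free measure of {0 <-> x}: increasing limit of the box measures.\<close>
definition phi0_connect :: "real \<Rightarrow> real \<Rightarrow> vert \<Rightarrow> real" where
  "phi0_connect p q x = lim (\<lambda>n. fk_free_prob n p q (\<lambda>\<omega>. connects \<omega> (0, 0) x))"

definition p_crit :: "real \<Rightarrow> real" where
  "p_crit q = sqrt q / (1 + sqrt q)"

end

theory Submission
  imports Defs
begin

text \<open>
  Walking around the clusters of a configuration with the cluster on the left permutes the corners of
  the lattice. By Euler's formula the number of orbits of this permutation turns the FK weight at
  the self-dual point into sqrt q to the number of orbits, up to a constant. In a simply connected
  domain, follow the orbit that starts at a boundary corner of the origin, let w be its number of left
  turns minus its number of right turns on arrival at a corner, and give the corner the factor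
  c(w) = cos (psi (w - 1)), where 2 cos psi = sqrt q, so that c(w+1) + c(w-1) = sqrt q c(w).
  Opening or closing an edge merges or splits orbits, and by this recurrence the
  contributions of the edge cancel. What remains is a sum over the boundary: connection
  probabilities to the origin weighted by c(w), where w depends only on the boundary
  corner, because every orbit that visits the boundary has total turning 4.

  In the box of radius n slit along a half-axis ending at the origin, w - 1 is 3 or -3 on
  the slit, where the weight cos (3 psi) = (q - 3) cos psi is nonpositive for q at most 3. Hence the
  connection probabilities to the boundary of the box alone have sum bounded below, uniformly in n.
  By the FKG inequality they are at most those in infinite volume, and one sums over n.
\<close>

section \<open>Orbits of permutations and transpositions\<close>

text \<open>The recurrence is invariant under shifts of w, so the centre 1 in cos (psi (w - 1)) is a
  free choice: the two sides of the slit are met with turning -2 and 4, and 1 is their midpoint, so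
  both receive the same value cos (3 psi). The slit is there because the origin has to be a boundary
  point of a simply connected domain. The boundary sum equals c(0) + c(1) + c(2) + c(3). The last
  term is exactly the contribution of the corner where the tour ends: it sits at the origin, with
  connection probability 1. So 1 + sqrt q is left for all other corners. Planarity is handled by
  counting alone. Euler's formula is used only to learn that a closed edge with connected endpoints
  has both sides on one orbit (\<open>connected_same_orbit\<close>). The turning on arrival is
  compared before and after a change of one edge by counting from the start for points ahead of the
  cut and from the end for points behind it; this is why the total turning of the orbit must be 4 in
  every configuration.\<close>

definition orb :: "('a \<Rightarrow> 'a) \<Rightarrow> 'a \<Rightarrow> 'a set" where
  "orb f x = range (\<lambda>k. (f ^^ k) x)"

definition periodic :: "('a \<Rightarrow> 'a) \<Rightarrow> 'a \<Rightarrow> bool" where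
  "periodic f x \<longleftrightarrow> (\<exists>k>0. (f ^^ k) x = x)"

definition per :: "('a \<Rightarrow> 'a) \<Rightarrow> 'a \<Rightarrow> nat" where
  "per f x = (LEAST k. 0 < k \<and> (f ^^ k) x = x)"

text \<open>With \<open>t\<close> the turning, this is the winding on arrival: the term of
  \<open>c\<close> itself is excluded. It is meaningful only for \<open>c\<close> in
  \<open>orb f x\<close>, since otherwise the \<open>LEAST\<close> is unspecified.\<close>

definition lift :: "('a \<Rightarrow> 'a) \<Rightarrow> ('a \<Rightarrow> int) \<Rightarrow> 'a \<Rightarrow> 'a \<Rightarrow> int" where
  "lift f t x c = (\<Sum>l<(LEAST k. (f ^^ k) x = c). t ((f ^^ l) x))"

text \<open>\<open>g\<close> is \<open>f\<close> composed with the transposition of \<open>a\<close>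
  and \<open>b\<close>. Opening or closing one edge changes the walk in exactly this way.\<close>

definition swapped :: "('a \<Rightarrow> 'a) \<Rightarrow> ('a \<Rightarrow> 'a) \<Rightarrow> 'a \<Rightarrow> 'a \<Rightarrow> bool" where
  "swapped f g a b \<longleftrightarrow> g a = f b \<and> g b = f a \<and> (\<forall>c. c \<noteq> a \<longrightarrow> c \<noteq> b \<longrightarrow> g c = f c)"

lemma swapped_sym: "swapped f g a b \<Longrightarrow> swapped g f a b"
  by (auto simp: swapped_def)

lemma swapped_commute: "swapped f g a b \<Longrightarrow> swapped f g b a"
  by (auto simp: swapped_def)

lemma orb_self [simp, intro]: "x \<in> orb f x"
  unfolding orb_def by (rule range_eqI[of _ _ 0]) simp

lemma orb_step: "y \<in> orb f x \<Longrightarrow> f y \<in> orb f x"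
  unfolding orb_def by (auto intro: range_eqI[of _ _ "Suc _"])

lemma orb_funpow [intro]: "(f ^^ k) x \<in> orb f x"
  by (auto simp: orb_def)

lemma orb_least: "orb f x \<subseteq> S" if "x \<in> S" "\<And>y. y \<in> S \<Longrightarrow> f y \<in> S"
proof -
  have "(f ^^ k) x \<in> S" for k by (induction k) (use that in auto)
  then show ?thesis by (auto simp: orb_def)
qed

lemma orb_mono: "y \<in> orb f x \<Longrightarrow> orb f y \<subseteq> orb f x"
  by (rule orb_least) (auto intro: orb_step)

lemma periodic_multiple: "(f ^^ k) x = x \<Longrightarrow> (f ^^ (n * k)) x = x"
  by (induction n) (auto simp: funpow_add)

lemma orb_sym: assumes "periodic f x" "y \<in> orb f x" shows "x \<in> orb f y"
proof -
  obtain k where k: "k > 0" "(f ^^ k) x = x" using assms(1) by (auto simp: periodic_def)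
  obtain j where j: "y = (f ^^ j) x" using assms(2) by (auto simp: orb_def)
  have "j \<le> j * k" using k by simp
  then have "(f ^^ (j * k - j)) y = (f ^^ (j * k)) x"
    unfolding j by (simp flip: funpow_add comp_apply[of "f ^^ _"])
  then have "(f ^^ (j * k - j)) y = x" using periodic_multiple[OF k(2)] by simp
  then show ?thesis by (metis orb_funpow)
qed

lemma orb_eq: "periodic f x \<Longrightarrow> y \<in> orb f x \<Longrightarrow> orb f y = orb f x"
  by (meson orb_mono orb_sym subset_antisym)

lemma periodic_finite:
  assumes "inj f" "finite S" "x \<in> S" "\<And>y. y \<in> S \<Longrightarrow> f y \<in> S"
  shows "periodic f x"
proof -
  have "orb f x \<subseteq> S" using assms by (intro orb_least) auto
  then have "finite (orb f x)" using assms(2) finite_subset by blast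
  moreover have "orb f x = {y. \<exists>n. y = (f ^^ n) x}" by (auto simp: orb_def)
  ultimately show ?thesis
    using funpow_inj_finite[OF assms(1), of x] by (auto simp: periodic_def)
qed

lemma per_props: assumes "periodic f x" shows "per f x > 0" "(f ^^ per f x) x = x"
  using LeastI_ex[of "\<lambda>k. 0 < k \<and> (f ^^ k) x = x"] assms by (auto simp: per_def periodic_def)

lemma per_le: "0 < k \<Longrightarrow> (f ^^ k) x = x \<Longrightarrow> per f x \<le> k"
  unfolding per_def by (rule Least_le) simp

lemma funpow_eq_less:
  assumes "inj f" "j \<le> k" "(f ^^ j) x = (f ^^ k) x" shows "(f ^^ (k - j)) x = x"
proof -
  have "(f ^^ j) ((f ^^ (k - j)) x) = (f ^^ j) x"
    using assms by (simp flip: funpow_add comp_apply[of "f ^^ _"])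
  then show ?thesis using inj_fn[OF assms(1), of j] by (auto dest: injD)
qed

lemma funpow_inj_per:
  assumes "inj f" "j < per f x" "k < per f x" "(f ^^ j) x = (f ^^ k) x" shows "j = k"
proof (rule ccontr)
  assume "j \<noteq> k"
  then consider "j < k" | "k < j" by linarith
  then show False
  proof cases
    case 1
    then have "(f ^^ (k - j)) x = x" using assms by (intro funpow_eq_less) auto
    then have "per f x \<le> k - j" using 1 by (intro per_le) auto
    then show False using assms by linarith
  next
    case 2
    then have "(f ^^ (j - k)) x = x" using assms by (intro funpow_eq_less) auto
    then have "per f x \<le> j - k" using 2 by (intro per_le) auto
    then show False using assms by linarith
  qed
qed

lemma orb_per: assumes "periodic f x" shows "orb f x = (\<lambda>k. (f ^^ k) x) ` {..<per f x}"
proof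
  show "orb f x \<subseteq> (\<lambda>k. (f ^^ k) x) ` {..<per f x}"
  proof (rule orb_least)
    show "x \<in> (\<lambda>k. (f ^^ k) x) ` {..<per f x}"
      using per_props[OF assms] by (intro image_eqI[of _ _ 0]) auto
    fix y assume "y \<in> (\<lambda>k. (f ^^ k) x) ` {..<per f x}"
    then obtain k where k: "k < per f x" "y = (f ^^ k) x" by auto
    show "f y \<in> (\<lambda>k. (f ^^ k) x) ` {..<per f x}"
    proof (cases "Suc k < per f x")
      case True then show ?thesis using k by (intro image_eqI[of _ _ "Suc k"]) auto
    next
      case False
      then have "Suc k = per f x" using k by linarith
      then have "f y = x" using per_props(2)[OF assms] k by (metis comp_apply funpow.simps(2))
      then show ?thesis using per_props[OF assms] by (intro image_eqI[of _ _ 0]) auto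
    qed
  qed
qed (auto simp: orb_def)

lemma finite_orb: "periodic f x \<Longrightarrow> finite (orb f x)"
  by (simp add: orb_per)

lemma sum_orb:
  assumes "inj f" "periodic f x" shows "sum t (orb f x) = (\<Sum>l<per f x. t ((f ^^ l) x))"
  unfolding orb_per[OF assms(2)]
  by (subst sum.reindex) (auto intro!: inj_onI dest: funpow_inj_per[OF assms(1)])

lemma Least_funpow:
  assumes "inj f" "k < per f x" shows "(LEAST j. (f ^^ j) x = (f ^^ k) x) = k"
proof (rule Least_equality)
  fix j assume j: "(f ^^ j) x = (f ^^ k) x"
  show "k \<le> j"
  proof (rule ccontr)
    assume "\<not> k \<le> j"
    then have "j = k" using assms j by (intro funpow_inj_per[of f j x k]) auto
    with \<open>\<not> k \<le> j\<close> show False by simp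
  qed
qed simp

lemma lift_funpow:
  assumes "inj f" "k < per f x" shows "lift f t x ((f ^^ k) x) = (\<Sum>l<k. t ((f ^^ l) x))"
  unfolding lift_def Least_funpow[OF assms] ..

lemma orb_obtain:
  assumes "periodic f x" "c \<in> orb f x" obtains k where "k < per f x" "c = (f ^^ k) x"
  using assms by (auto simp: orb_per)

lemma lift_last:
  assumes "inj f" "periodic f x" "f c = x" "c \<in> orb f x"
  shows "lift f t x c + t c = sum t (orb f x)"
proof -
  obtain k where k: "k < per f x" "c = (f ^^ k) x" using assms orb_obtain by metis
  have "(f ^^ Suc k) x = x" using assms k by simp
  then have "per f x \<le> Suc k" by (intro per_le) auto
  then have p: "per f x = Suc k" using k by linarith
  show ?thesis unfolding sum_orb[OF assms(1,2)] p
    using lift_funpow[OF assms(1) k(1), of t] k(2) by simp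
qed

lemma orb_congr:
  assumes "\<And>c. c \<in> orb f x \<Longrightarrow> g c = f c"
  shows "(g ^^ k) x = (f ^^ k) x" "orb g x = orb f x"
proof -
  show *: "(g ^^ k) x = (f ^^ k) x" for k by (induction k) (auto simp: assms orb_funpow)
  show "orb g x = orb f x" by (simp add: orb_def *)
qed

lemma lift_congr:
  assumes "\<And>c. c \<in> orb f x \<Longrightarrow> g c = f c" "\<And>c. c \<in> orb f x \<Longrightarrow> t c = t' c"
  shows "lift g t' x c = lift f t x c"
proof -
  have *: "(g ^^ k) x = (f ^^ k) x" for k using assms(1) by (rule orb_congr)
  show ?thesis unfolding lift_def * by (rule sum.cong) (auto simp: assms(2) orb_funpow)
qed

lemma orb_swapped_other:
  assumes "swapped f g a b" "a \<notin> orb f c" "b \<notin> orb f c"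
  shows "orb g c = orb f c"
  using assms by (intro orb_congr) (auto simp: swapped_def)

text \<open>If the orbit passes through a before b, the exchange short-cuts it from a to the
  successor of b.\<close>

locale surgery =
  fixes f g :: "'a \<Rightarrow> 'a" and a b r :: 'a and i j :: nat
  assumes inj: "inj f" and per: "periodic f r" and sw: "swapped f g a b"
    and ij: "i < j" "j < per f r" and ai: "(f ^^ i) r = a" and bj: "(f ^^ j) r = b"
begin

abbreviation "x k \<equiv> (f ^^ k) r"

lemma x_eq_a: "k < per f r \<Longrightarrow> x k = a \<longleftrightarrow> k = i"
  using funpow_inj_per[OF inj, of k r i] ij ai by auto

lemma x_eq_b: "k < per f r \<Longrightarrow> x k = b \<longleftrightarrow> k = j"
  using funpow_inj_per[OF inj, of k r j] ij bj by auto

lemma prefix: "k \<le> i \<Longrightarrow> (g ^^ k) r = x k"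
proof (induction k)
  case (Suc k)
  then have "x k \<noteq> a" "x k \<noteq> b" using x_eq_a[of k] x_eq_b[of k] ij by auto
  then show ?case using Suc sw by (simp add: swapped_def)
qed simp

lemma suffix: "j + 1 + k \<le> per f r \<Longrightarrow> (g ^^ (i + 1 + k)) r = x (j + 1 + k)"
proof (induction k)
  case 0
  have "g a = f b" using sw by (simp add: swapped_def)
  then show ?case using prefix[of i] ai bj by simp
next
  case (Suc k)
  have "x (j + 1 + k) \<noteq> a" "x (j + 1 + k) \<noteq> b"
    using Suc.prems x_eq_a[of "j + 1 + k"] x_eq_b[of "j + 1 + k"] ij by auto
  then have "g (x (j + 1 + k)) = f (x (j + 1 + k))" using sw by (simp add: swapped_def)
  then show ?case using Suc by simp
qed

text \<open>Length of the shortened orbit: the points up to and including \<open>a\<close>, then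
  those strictly after \<open>b\<close>.\<close>

definition "m = i + 1 + (per f r - (j + 1))"

lemma gm: "(g ^^ m) r = r"
proof -
  have "(g ^^ m) r = x (j + 1 + (per f r - (j + 1)))"
    unfolding m_def using ij by (intro suffix) auto
  also have "\<dots> = r" using per_props(2)[OF per] ij by simp
  finally show ?thesis .
qed

lemma g_pow: assumes "k < m"
  shows "(g ^^ k) r = x (if k \<le> i then k else k - i + j)"
proof (cases "k \<le> i")
  case False
  then obtain l where l: "k = i + 1 + l" by (metis Suc_eq_plus1 add_Suc le_iff_add not_less_eq_eq)
  have "(g ^^ k) r = x (j + 1 + l)"
    unfolding l using assms ij by (intro suffix) (auto simp: m_def l)
  then show ?thesis using False l by (simp add: add.commute)
qed (simp add: prefix)

lemma g_index_less: "k < m \<Longrightarrow> (if k \<le> i then k else k - i + j) < per f r"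
  using ij by (auto simp: m_def)

lemma per_g: "per f r - (j - i) = m" "per g r = m" "periodic g r"
proof -
  show "per f r - (j - i) = m" using ij by (auto simp: m_def)
  show p: "periodic g r" unfolding periodic_def using gm by (intro exI[of _ m]) (auto simp: m_def)
  have "per g r \<le> m" using gm by (intro per_le) (auto simp: m_def)
  moreover have "\<not> per g r < m"
  proof
    assume l: "per g r < m"
    let ?k = "if per g r \<le> i then per g r else per g r - i + j"
    have "x ?k = x 0" using g_pow[OF l] per_props(2)[OF p] by simp
    then have "?k = 0"
      using g_index_less[OF l] by (intro funpow_inj_per[OF inj, of _ r]) auto
    then show False using per_props(1)[OF p] by (auto split: if_splits)
  qed
  ultimately show "per g r = m" by linarith
qed

lemma a_in: "a \<in> orb g r" using prefix[of i] ai by (metis orb_funpow order_refl)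

lemma b_notin: "b \<notin> orb g r"
proof
  assume "b \<in> orb g r"
  then obtain k where k: "k < m" "b = (g ^^ k) r"
    using orb_obtain[OF per_g(3)] per_g(2) by metis
  then have "(if k \<le> i then k else k - i + j) = j"
    using x_eq_b[OF g_index_less[OF k(1)]] g_pow[OF k(1)] by simp
  then show False using ij by (auto split: if_splits)
qed

lemma inj_g: "inj g"
proof (rule injI)
  fix u v assume "g u = g v"
  then show "u = v" using sw injD[OF inj] unfolding swapped_def by metis
qed

lemma lift_a: "(\<And>c. c \<noteq> a \<Longrightarrow> c \<noteq> b \<Longrightarrow> t' c = t c) \<Longrightarrow> lift g t' r a = lift f t r a"
proof -
  assume t: "\<And>c. c \<noteq> a \<Longrightarrow> c \<noteq> b \<Longrightarrow> t' c = t c"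
  have "lift g t' r a = (\<Sum>l<i. t' ((g ^^ l) r))"
    using lift_funpow[OF inj_g, of i r t'] per_g(2) prefix[of i] ai by (simp add: m_def)
  also have "\<dots> = (\<Sum>l<i. t (x l))"
    using ij x_eq_a x_eq_b by (intro sum.cong) (auto simp: prefix t)
  also have "\<dots> = lift f t r a" using lift_funpow[OF inj, of i r t] ai ij by simp
  finally show ?thesis .
qed

lemma suffix_sum:
  assumes t: "\<And>c. c \<noteq> a \<Longrightarrow> c \<noteq> b \<Longrightarrow> t' c = t c" and "l \<le> m - (i + 1)"
  shows "(\<Sum>k = i+1+l..<m. t' ((g ^^ k) r)) = (\<Sum>k = j+1+l..<per f r. t (x k))"
proof -
  have m: "per f r = m + (j - i)" using per_g(1) ij by (simp add: m_def)
  have "(\<Sum>k = j+1+l..<per f r. t (x k)) = (\<Sum>k = i+1+l+(j-i)..<m + (j-i). t (x k))"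
    using ij m by (intro sum.cong) auto
  also have "\<dots> = (\<Sum>k = i+1+l..<m. t (x (k + (j - i))))"
    by (subst sum.shift_bounds_nat_ivl) simp
  also have "\<dots> = (\<Sum>k = i+1+l..<m. t' ((g ^^ k) r))"
  proof (rule sum.cong)
    fix k assume k: "k \<in> {i+1+l..<m}"
    then have e: "(g ^^ k) r = x (k + (j - i))" using g_pow[of k] ij by (auto simp: add.commute)
    have "k + (j - i) < per f r" "k + (j-i) > j" using k m ij by auto
    then have "x (k + (j - i)) \<noteq> a" "x (k + (j - i)) \<noteq> b"
      using x_eq_a[of "k + (j-i)"] x_eq_b[of "k + (j-i)"] ij by auto
    then show "t (x (k + (j - i))) = t' ((g ^^ k) r)" using t e by simp
  qed simp
  finally show ?thesis ..
qed

text \<open>What follows \<open>b\<close> under \<open>f\<close> and what follows \<open>a\<close>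
  under \<open>g\<close> agree point by point. As the totals agree, so do the sums up to and
  including these two points.\<close>

lemma lift_ab:
  assumes t: "\<And>c. c \<noteq> a \<Longrightarrow> c \<noteq> b \<Longrightarrow> t' c = t c"
    and T: "sum t (orb f r) = sum t' (orb g r)"
  shows "lift f t r b + t b = lift g t' r a + t' a"
proof -
  have im: "i < m" by (simp add: m_def)
  have ga: "(g ^^ i) r = a" using prefix[of i] ai by simp
  have 1: "sum t (orb f r) = lift f t r b + t b + (\<Sum>k=j+1..<per f r. t (x k))"
  proof -
    have "sum t (orb f r) = (\<Sum>k<j. t (x k)) + (\<Sum>k=j..<per f r. t (x k))"
      using sum_orb[OF inj per, of t] ij
      by (metis (no_types, lifting) ivl_disj_int(8) ivl_disj_un_one(2) less_imp_le finite_lessThan finite_atLeastLessThan ivl_disj_int_one(2) sum.union_disjoint)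
    also have "(\<Sum>k=j..<per f r. t (x k)) = t b + (\<Sum>k=j+1..<per f r. t (x k))"
      using ij bj by (subst sum.atLeast_Suc_lessThan) auto
    finally show ?thesis using lift_funpow[OF inj, of j r t] ij bj by simp
  qed
  have 2: "sum t' (orb g r) = lift g t' r a + t' a + (\<Sum>k=i+1..<m. t' ((g ^^ k) r))"
  proof -
    have "sum t' (orb g r) = (\<Sum>k<i. t' ((g ^^ k) r)) + (\<Sum>k=i..<m. t' ((g ^^ k) r))"
      using sum_orb[OF inj_g per_g(3), of t'] im per_g(2)
      by (metis (no_types, lifting) ivl_disj_un_one(2) less_imp_le finite_lessThan finite_atLeastLessThan ivl_disj_int_one(2) sum.union_disjoint)
    also have "(\<Sum>k=i..<m. t' ((g ^^ k) r)) = t' a + (\<Sum>k=i+1..<m. t' ((g ^^ k) r))"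
      using im ga by (subst sum.atLeast_Suc_lessThan) auto
    finally show ?thesis using lift_funpow[OF inj_g, of i r t'] im ga per_g(2) by simp
  qed
  show ?thesis using 1 2 suffix_sum[of t' t 0, OF t] T by simp
qed

text \<open>A point ahead of the cut is reached along an unchanged prefix. A point behind it has an
  unchanged remainder of the orbit, and equality of the totals transfers this to the part before
  it.\<close>

lemma lift_common:
  assumes t: "\<And>c. c \<noteq> a \<Longrightarrow> c \<noteq> b \<Longrightarrow> t' c = t c"
    and T: "sum t (orb f r) = sum t' (orb g r)" and c: "c \<in> orb g r"
  shows "lift g t' r c = lift f t r c"
proof -
  obtain k where k: "k < m" "c = (g ^^ k) r" using c orb_obtain[OF per_g(3)] per_g(2) by metis
  have lg: "lift g t' r c = (\<Sum>l<k. t' ((g ^^ l) r))"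
    unfolding k(2) using k per_g by (intro lift_funpow inj_g) auto
  show ?thesis
  proof (cases "k \<le> i")
    case True
    then have c: "c = x k" using k prefix by simp
    have "lift f t r c = (\<Sum>l<k. t (x l))"
      unfolding c using True ij by (intro lift_funpow inj) auto
    also have "\<dots> = (\<Sum>l<k. t' ((g ^^ l) r))"
    proof (rule sum.cong)
      fix l assume l: "l \<in> {..<k}"
      then have "x l \<noteq> a" "x l \<noteq> b" using x_eq_a[of l] x_eq_b[of l] ij True by auto
      then show "t (x l) = t' ((g ^^ l) r)" using prefix[of l] True l t by auto
    qed simp
    finally show ?thesis using lg by simp
  next
    case False
    then obtain l where l: "k = i + 1 + l"
      by (metis Suc_eq_plus1 add_Suc le_iff_add not_less_eq_eq)
    define k' where "k' = j + 1 + l"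
    have k': "k' < per f r" using k(1) ij by (simp add: k'_def l m_def)
    have c': "c = x k'" unfolding k(2) l k'_def using k' by (intro suffix) (simp add: k'_def)
    have lf: "lift f t r c = (\<Sum>l<k'. t (x l))" unfolding c' using k' by (intro lift_funpow inj)
    have 1: "sum t (orb f r) = (\<Sum>l<k'. t (x l)) + (\<Sum>l=k'..<per f r. t (x l))"
      using sum_orb[OF inj per, of t] k'
      by (metis (no_types, lifting) ivl_disj_un_one(2) less_imp_le finite_lessThan finite_atLeastLessThan ivl_disj_int_one(2) sum.union_disjoint)
    have 2: "sum t' (orb g r) = (\<Sum>l<k. t' ((g ^^ l) r)) + (\<Sum>l=k..<m. t' ((g ^^ l) r))"
      using sum_orb[OF inj_g per_g(3), of t'] k(1) per_g(2)
      by (metis (no_types, lifting) ivl_disj_un_one(2) less_imp_le finite_lessThan finite_atLeastLessThan ivl_disj_int_one(2) sum.union_disjoint)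
    show ?thesis using suffix_sum[of t' t l, OF t] 1 2 T lg lf k(1) by (simp add: k'_def l)
  qed
qed

end

text \<open>Surgery with the orbit started at \<open>a\<close> itself, so
  \<open>i = 0\<close>.\<close>

lemma split_or_merge:
  assumes "inj f" "periodic f a" "b \<in> orb f a" "a \<noteq> b" "swapped f g a b"
  shows "b \<notin> orb g a"
proof -
  obtain j where j: "j < per f a" "b = (f ^^ j) a" using assms orb_obtain by metis
  have "j > 0" using j assms(4) by (cases j) auto
  interpret surgery f g a b a 0 j
    by unfold_locales (use assms j \<open>j > 0\<close> in auto)
  show ?thesis by (rule b_notin)
qed

text \<open>Following f from b, one returns to b before meeting a; the exchange inserts this loop
  after a.\<close>

lemma merge_reaches:
  assumes "inj f" "periodic f b" "a \<notin> orb f b" "swapped f g a b"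
  shows "b \<in> orb g a"
proof -
  have "(g ^^ Suc k) a = (f ^^ Suc k) b" if "Suc k \<le> per f b" for k
    using that
  proof (induction k)
    case 0 then show ?case using assms(4) by (simp add: swapped_def)
  next
    case (Suc k)
    have "(f ^^ Suc k) b \<noteq> a" using assms(3) orb_funpow by metis
    moreover have "(f ^^ Suc k) b \<noteq> b"
    proof
      assume "(f ^^ Suc k) b = b"
      then have "per f b \<le> Suc k" by (intro per_le) auto
      then show False using Suc.prems by simp
    qed
    ultimately have "g ((f ^^ Suc k) b) = f ((f ^^ Suc k) b)"
      using assms(4) by (simp add: swapped_def)
    then show ?case using Suc by simp
  qed
  from this[of "per f b - 1"] have "(g ^^ per f b) a = b" using per_props[OF assms(2)] by simp
  then show ?thesis by (metis orb_funpow)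
qed

text \<open>The exchange only permutes values inside \<open>orb f a\<close>, so this set is closed
  under \<open>g\<close>; conversely each \<open>f y\<close> is \<open>g\<close> of
  \<open>y\<close>, of \<open>a\<close> or of \<open>b\<close>.\<close>

lemma orb_union:
  assumes pf: "\<And>c. c \<in> {a, b} \<Longrightarrow> periodic f c" and sw: "swapped f g a b" and b: "b \<in> orb f a"
  shows "orb f a = orb g a \<union> orb g b"
proof
  have "orb g c \<subseteq> orb f a" if "c \<in> {a, b}" for c
  proof (rule orb_least)
    show "c \<in> orb f a" using that b by auto
    fix y assume y: "y \<in> orb f a"
    then show "g y \<in> orb f a" using sw b orb_step[of _ f a] unfolding swapped_def
      by (cases "y = a \<or> y = b") auto
  qed
  then show "orb g a \<union> orb g b \<subseteq> orb f a" by auto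
  show "orb f a \<subseteq> orb g a \<union> orb g b"
  proof (rule orb_least)
    fix y assume y: "y \<in> orb g a \<union> orb g b"
    have "f y = g y \<or> f y = g a \<or> f y = g b" using sw unfolding swapped_def by metis
    then show "f y \<in> orb g a \<union> orb g b" using y orb_step orb_self by (metis Un_iff)
  qed auto
qed

section \<open>Positive association\<close>

text \<open>The four functions theorem on one point. Both cross terms u, v are at most X, and u v
  \<le> X Y; then (X - u) (X - v) \<ge> 0 gives X (u + v) \<le> X X + u v \<le> X (X + Y).\<close>

lemma four_numbers:
  fixes a0 a1 b0 b1 c0 c1 d0 d1 :: real
  assumes nn: "a0 \<ge> 0" "a1 \<ge> 0" "b0 \<ge> 0" "b1 \<ge> 0" "c0 \<ge> 0" "c1 \<ge> 0" "d0 \<ge> 0" "d1 \<ge> 0"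
    and h: "a0 * b0 \<le> c0 * d0" "a0 * b1 \<le> c1 * d0" "a1 * b0 \<le> c1 * d0" "a1 * b1 \<le> c1 * d1"
  shows "(a0 + a1) * (b0 + b1) \<le> (c0 + c1) * (d0 + d1)"
proof -
  define X u v Y where "X = c1 * d0" and "u = a0 * b1" and "v = a1 * b0" and "Y = c0 * d1"
  have nn': "X \<ge> 0" "u \<ge> 0" "v \<ge> 0" "Y \<ge> 0" using nn by (auto simp: X_def u_def v_def Y_def)
  have "u + v \<le> X + Y"
  proof (cases "X = 0")
    case True then show ?thesis using h nn' by (auto simp: X_def u_def v_def)
  next
    case False
    have "u * v = (a0 * b0) * (a1 * b1)" by (simp add: u_def v_def)
    also have "\<dots> \<le> (c0 * d0) * (c1 * d1)" using mult_mono[OF h(1) h(4)] nn by simp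
    finally have "u * v \<le> X * Y" by (simp add: X_def Y_def mult_ac)
    moreover have "0 \<le> (X - u) * (X - v)" using h by (simp add: X_def u_def v_def)
    ultimately have "X * (u + v) \<le> X * (X + Y)" by (simp add: algebra_simps)
    then show ?thesis using False nn' by simp
  qed
  then show ?thesis using h by (simp add: X_def Y_def u_def v_def algebra_simps)
qed

lemma sum_Pow_insert:
  assumes "finite S" "x \<notin> S"
  shows "sum f (Pow (insert x S)) = (\<Sum>A\<in>Pow S. f A + f (insert x A))"
proof -
  have "inj_on (insert x) (Pow S)" using assms by (intro inj_onI) (auto simp: insert_ident)
  moreover have "Pow S \<inter> insert x ` Pow S = {}" using assms by auto
  ultimately show ?thesis using assms
    by (simp add: Pow_insert sum.union_disjoint sum.reindex sum.distrib)
qed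

text \<open>The four functions theorem. Summing out one point \<open>x\<close> yields four functions
  on \<open>S\<close> that satisfy the hypothesis again, by \<open>four_numbers\<close>.\<close>

lemma ahlswede_daykin:
  fixes \<alpha> \<beta> \<gamma> \<delta> :: "'a set \<Rightarrow> real"
  assumes "finite S"
    and "\<And>A. \<alpha> A \<ge> 0" "\<And>A. \<beta> A \<ge> 0" "\<And>A. \<gamma> A \<ge> 0" "\<And>A. \<delta> A \<ge> 0"
    and "\<And>A B. A \<subseteq> S \<Longrightarrow> B \<subseteq> S \<Longrightarrow> \<alpha> A * \<beta> B \<le> \<gamma> (A \<union> B) * \<delta> (A \<inter> B)"
  shows "sum \<alpha> (Pow S) * sum \<beta> (Pow S) \<le> sum \<gamma> (Pow S) * sum \<delta> (Pow S)"
  using assms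
proof (induction S arbitrary: \<alpha> \<beta> \<gamma> \<delta> rule: finite_induct)
  case empty
  from empty(5)[of "{}" "{}"] show ?case by simp
next
  case (insert x S)
  note nn = insert.prems(1-4) and h = insert.prems(5)
  show ?case unfolding sum_Pow_insert[OF insert.hyps]
  proof (rule insert.IH)
    fix A B assume AB: "A \<subseteq> S" "B \<subseteq> S"
    then have x: "x \<notin> A" "x \<notin> B" using insert by auto
    have "\<alpha> A * \<beta> B \<le> \<gamma> (A \<union> B) * \<delta> (A \<inter> B)" using h[of A B] AB by auto
    moreover have "\<alpha> A * \<beta> (insert x B) \<le> \<gamma> (insert x (A \<union> B)) * \<delta> (A \<inter> B)"
      using h[of A "insert x B"] AB x by auto
    moreover have "\<alpha> (insert x A) * \<beta> B \<le> \<gamma> (insert x (A \<union> B)) * \<delta> (A \<inter> B)"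
      using h[of "insert x A" B] AB x by auto
    moreover have "\<alpha> (insert x A) * \<beta> (insert x B) \<le> \<gamma> (insert x (A \<union> B)) * \<delta> (insert x (A \<inter> B))"
      using h[of "insert x A" "insert x B"] AB by auto
    ultimately show "(\<alpha> A + \<alpha> (insert x A)) * (\<beta> B + \<beta> (insert x B))
      \<le> (\<gamma> (A \<union> B) + \<gamma> (insert x (A \<union> B))) * (\<delta> (A \<inter> B) + \<delta> (insert x (A \<inter> B)))"
      by (intro four_numbers nn)
  qed (use nn in auto)
qed

text \<open>The FKG-type comparison: forcing the edges of \<open>E' - E\<close> to be closed lowers
  the probability of an increasing event.\<close>

lemma supermodular_mono:
  fixes w :: "'a set \<Rightarrow> real"
  assumes fin: "finite E'" and sub: "E \<subseteq> E'" and pos: "\<And>A. w A > 0"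
    and sm: "\<And>A B. A \<subseteq> E' \<Longrightarrow> B \<subseteq> E' \<Longrightarrow> w A * w B \<le> w (A \<union> B) * w (A \<inter> B)"
    and inc: "\<And>A B. A \<subseteq> B \<Longrightarrow> I A \<Longrightarrow> I B"
  shows "(\<Sum>A\<in>{A. A \<subseteq> E \<and> I A}. w A) / sum w (Pow E)
       \<le> (\<Sum>A\<in>{A. A \<subseteq> E' \<and> I A}. w A) / sum w (Pow E')"
proof -
  let ?i = "\<lambda>P x. if P then x else (0::real)"
  have fE: "finite E" using fin sub finite_subset by blast
  have r: "sum w {A. A \<subseteq> X \<and> Q A} = (\<Sum>A\<in>Pow E'. ?i (A \<subseteq> X \<and> Q A) (w A))" if "X \<subseteq> E'" for X Q
    using that fin by (intro sum.mono_neutral_cong_left) auto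
  have "(\<Sum>A\<in>Pow E'. ?i (A \<subseteq> E \<and> I A) (w A)) * (\<Sum>A\<in>Pow E'. ?i (A \<subseteq> E' \<and> True) (w A))
      \<le> (\<Sum>A\<in>Pow E'. ?i (A \<subseteq> E' \<and> I A) (w A)) * (\<Sum>A\<in>Pow E'. ?i (A \<subseteq> E \<and> True) (w A))"
  \<comment> \<open>All four functions are \<open>w\<close> under different restrictions: the union
    inherits the event from \<open>A\<close>, the intersection inherits
    \<open>A \<subseteq> E\<close>.\<close>
  proof (rule ahlswede_daykin[OF fin])
    fix A B assume "A \<subseteq> E'" "B \<subseteq> E'"
    then show "?i (A \<subseteq> E \<and> I A) (w A) * ?i (B \<subseteq> E' \<and> True) (w B)
      \<le> ?i (A \<union> B \<subseteq> E' \<and> I (A \<union> B)) (w (A \<union> B)) * ?i (A \<inter> B \<subseteq> E \<and> True) (w (A \<inter> B))"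
      using sm[of A B] inc[of A "A \<union> B"] less_imp_le[OF pos] by auto
  qed (use less_imp_le[OF pos] in auto)
  then have "sum w {A. A \<subseteq> E \<and> I A} * sum w {A. A \<subseteq> E' \<and> True}
    \<le> sum w {A. A \<subseteq> E' \<and> I A} * sum w {A. A \<subseteq> E \<and> True}"
    using r[OF sub, of I] r[of E' "\<lambda>_. True"] r[of E' I] r[OF sub, of "\<lambda>_. True"] by simp
  moreover have "sum w (Pow E) > 0" "sum w (Pow E') > 0"
    using fin fE pos by (auto intro!: sum_pos)
  ultimately show ?thesis by (simp add: divide_simps Pow_def mult.commute)
qed

section \<open>Clusters and monotonicity in the domain\<close>

definition nc :: "vert set \<Rightarrow> vert set set \<Rightarrow> nat" where
  "nc V \<omega> = card (V // {(x, y). x \<in> V \<and> y \<in> V \<and> connects \<omega> x y})"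

definition edges_in :: "vert set \<Rightarrow> vert set set" where
  "edges_in V = {{u, v} | u v. u \<in> V \<and> v \<in> V \<and> adjacent u v}"

definition cl :: "vert set \<Rightarrow> vert set set \<Rightarrow> vert \<Rightarrow> vert set" where
  "cl V \<omega> x = {y \<in> V. connects \<omega> x y}"

section \<open>Connectivity when an edge is added\<close>

lemma connects_refl [simp, intro]: "connects \<omega> x x"
  by (simp add: connects_def)

lemma connects_trans: "connects \<omega> x y \<Longrightarrow> connects \<omega> y z \<Longrightarrow> connects \<omega> x z"
  unfolding connects_def by (rule rtrancl_trans)

lemma connects_sym: "connects \<omega> x y \<Longrightarrow> connects \<omega> y x"
proof -
  have "sym (open_rel \<omega>)" by (auto simp: sym_def open_rel_def insert_commute)
  then show "connects \<omega> x y \<Longrightarrow> connects \<omega> y x"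
    unfolding connects_def by (meson sym_rtrancl symD)
qed

lemma connects_edge: "{x, y} \<in> \<omega> \<Longrightarrow> connects \<omega> x y"
  unfolding connects_def open_rel_def by (rule r_into_rtrancl) simp

lemma connects_mono: "connects \<omega> x y \<Longrightarrow> \<omega> \<subseteq> \<omega>' \<Longrightarrow> connects \<omega>' x y"
  unfolding connects_def using rtrancl_mono[of "open_rel \<omega>" "open_rel \<omega>'"]
  by (auto simp: open_rel_def)

lemma connects_induct:
  assumes "connects \<omega> x y" "P x" "\<And>y z. connects \<omega> x y \<Longrightarrow> {y, z} \<in> \<omega> \<Longrightarrow> P y \<Longrightarrow> P z"
  shows "P y"
  using assms(1) unfolding connects_def
  by (induction rule: rtrancl_induct) (use assms in \<open>auto simp: connects_def open_rel_def\<close>)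

lemma connects_insert:
  "connects (insert {u, v} \<omega>) x y \<longleftrightarrow>
    connects \<omega> x y \<or> (connects \<omega> x u \<and> connects \<omega> v y) \<or> (connects \<omega> x v \<and> connects \<omega> u y)"
    (is "?l \<longleftrightarrow> ?r")
proof
  assume ?l
  then show ?r
  proof (rule connects_induct)
    show "connects \<omega> x x \<or> (connects \<omega> x u \<and> connects \<omega> v x) \<or> (connects \<omega> x v \<and> connects \<omega> u x)"
      by simp
    fix y z
    assume e: "{y, z} \<in> insert {u, v} \<omega>"
      and IH: "connects \<omega> x y \<or> (connects \<omega> x u \<and> connects \<omega> v y) \<or> (connects \<omega> x v \<and> connects \<omega> u y)"
    from e consider "{y, z} \<in> \<omega>" | "y = u" "z = v" | "y = v" "z = u" by (auto simp: doubleton_eq_iff)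
    then show "connects \<omega> x z \<or> (connects \<omega> x u \<and> connects \<omega> v z) \<or> (connects \<omega> x v \<and> connects \<omega> u z)"
    proof cases
      case 1 then show ?thesis using IH connects_edge connects_trans by blast
    next
      case 2 then show ?thesis using IH connects_trans connects_sym connects_refl by blast
    next
      case 3 then show ?thesis using IH connects_trans connects_sym connects_refl by blast
    qed
  qed
next
  have m: "connects \<omega> a b \<Longrightarrow> connects (insert {u, v} \<omega>) a b" for a b
    by (rule connects_mono) auto
  have "connects (insert {u, v} \<omega>) u v" by (rule connects_edge) simp
  then have uv: "connects (insert {u, v} \<omega>) u v" "connects (insert {u, v} \<omega>) v u"
    using connects_sym by auto
  assume ?r
  then show ?l using m[of x] m[of _ y] connects_trans[OF _ uv(1)] connects_trans[OF _ uv(2)]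
    by (elim disjE conjE) (blast intro: connects_trans)+
qed

lemma connects_insert_connected:
  assumes "connects \<omega> u v" shows "connects (insert {u, v} \<omega>) = connects \<omega>"
proof (intro ext)
  fix x y
  show "connects (insert {u, v} \<omega>) x y = connects \<omega> x y"
    using assms connects_sym[OF assms] connects_trans[of \<omega>] unfolding connects_insert by blast
qed

lemma connects_empty: "connects {} x y \<longleftrightarrow> x = y"
  by (simp add: connects_def open_rel_def)

section \<open>Counting clusters\<close>

lemma nc_cl: "nc V \<omega> = card (cl V \<omega> ` V)"
proof -
  have "V // {(x, y). x \<in> V \<and> y \<in> V \<and> connects \<omega> x y} = cl V \<omega> ` V"
    by (auto simp: quotient_def cl_def Image_def)
  then show ?thesis by (simp add: nc_def)
qed

lemma cl_self: "x \<in> V \<Longrightarrow> x \<in> cl V \<omega> x" by (simp add: cl_def)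

lemma cl_cong: "connects \<omega> x y \<Longrightarrow> cl V \<omega> x = cl V \<omega> y"
  unfolding cl_def using connects_trans connects_sym by blast

lemma nc_insert_connected: "connects \<omega> u v \<Longrightarrow> nc V (insert {u, v} \<omega>) = nc V \<omega>"
  by (simp add: nc_def connects_insert_connected)

lemma nc_insert_disconnected:
  assumes fin: "finite V" and uv: "u \<in> V" "v \<in> V" and nuv: "\<not> connects \<omega> u v"
  shows "nc V \<omega> = Suc (nc V (insert {u, v} \<omega>))"
proof -
  let ?\<omega>' = "insert {u, v} \<omega>"
  define R where "R = {x \<in> V. \<not> connects \<omega> x u \<and> \<not> connects \<omega> x v}"
  have nvu: "\<not> connects \<omega> v u" using nuv connects_sym by blast
  have R: "cl V ?\<omega>' x = cl V \<omega> x" if "x \<in> R" for x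
    using that by (auto simp: cl_def R_def connects_insert)
  have U: "cl V ?\<omega>' x = cl V \<omega> u \<union> cl V \<omega> v" if "connects \<omega> x u \<or> connects \<omega> x v" for x
    using that unfolding cl_def connects_insert using connects_sym connects_trans by blast
  have RV: "R \<subseteq> V" by (auto simp: R_def)
  have 1: "cl V ?\<omega>' ` V = insert (cl V \<omega> u \<union> cl V \<omega> v) (cl V \<omega> ` R)" (is "?L = ?R")
  proof
    show "?L \<subseteq> ?R"
    proof
      fix c assume "c \<in> ?L"
      then obtain x where x: "x \<in> V" "c = cl V ?\<omega>' x" by auto
      show "c \<in> ?R"
      proof (cases "x \<in> R")
        case True then show ?thesis using R x by blast
      next
        case False then show ?thesis using U[of x] x by (auto simp: R_def)
      qed
    qed
    have "cl V \<omega> x \<in> ?L" if "x \<in> R" for x using R[OF that] that RV by (metis image_eqI subsetD)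
    then show "?R \<subseteq> ?L" using U[of u] uv by (auto intro: image_eqI[of _ _ u])
  qed
  have 2: "cl V \<omega> ` V = insert (cl V \<omega> u) (insert (cl V \<omega> v) (cl V \<omega> ` R))" (is "?L = ?R")
  proof
    show "?L \<subseteq> ?R"
    proof
      fix c assume "c \<in> ?L"
      then obtain x where x: "x \<in> V" "c = cl V \<omega> x" by auto
      show "c \<in> ?R" using cl_cong[of \<omega> x u V] cl_cong[of \<omega> x v V] x by (auto simp: R_def)
    qed
    show "?R \<subseteq> ?L" using uv RV by auto
  qed
  have n1: "cl V \<omega> u \<union> cl V \<omega> v \<notin> cl V \<omega> ` R"
    using cl_self[OF uv(1), of \<omega>] by (auto simp: cl_def R_def)
  have n2: "cl V \<omega> u \<notin> cl V \<omega> ` R" "cl V \<omega> v \<notin> cl V \<omega> ` R"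
    using cl_self[OF uv(1), of \<omega>] cl_self[OF uv(2), of \<omega>] by (auto simp: cl_def R_def)
  have n3: "cl V \<omega> u \<noteq> cl V \<omega> v" using cl_self[OF uv(2), of \<omega>] nuv by (auto simp: cl_def)
  have "finite R" using fin RV finite_subset by blast
  then show ?thesis unfolding nc_cl 1 2 using n1 n2 n3 by simp
qed

lemma nc_empty: "nc V {} = card V"
proof -
  have "cl V {} x = {x}" if "x \<in> V" for x using that by (auto simp: cl_def connects_empty)
  then have "cl V {} ` V = (\<lambda>x. {x}) ` V" by (intro image_cong) auto
  then show ?thesis unfolding nc_cl by (simp add: card_image)
qed

lemma edges_in_mono: "V \<subseteq> V' \<Longrightarrow> edges_in V \<subseteq> edges_in V'"
  unfolding edges_in_def by blast

lemma finite_edges_in: "finite V \<Longrightarrow> finite (edges_in V)"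
proof -
  assume "finite V"
  moreover have "edges_in V \<subseteq> (\<lambda>(u, v). {u, v}) ` (V \<times> V)" by (auto simp: edges_in_def)
  ultimately show ?thesis by (meson finite_SigmaI finite_imageI finite_subset)
qed

lemma edges_inE:
  assumes "e \<in> edges_in V" obtains u v where "e = {u, v}" "u \<in> V" "v \<in> V" "adjacent u v"
  using assms by (auto simp: edges_in_def)

text \<open>Add the edges of \<open>X\<close> one at a time to both configurations: whenever an edge
  merges two clusters over the larger one, it does so over the smaller one too.\<close>

lemma nc_union_diff:
  assumes V: "finite V" and X: "finite X" "X \<subseteq> edges_in V" and IA: "I \<subseteq> A"
  shows "nc V A + nc V (I \<union> X) \<le> nc V (A \<union> X) + nc V I"
  using X
proof (induction X rule: finite_induct)
  case (insert e X)
  then obtain u v where e: "e = {u, v}" "u \<in> V" "v \<in> V" by (auto elim: edges_inE)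
  have IH: "nc V A + nc V (I \<union> X) \<le> nc V (A \<union> X) + nc V I" using insert by auto
  have "connects (I \<union> X) u v \<Longrightarrow> connects (A \<union> X) u v" by (rule connects_mono) (use IA in auto)
  then have "nc V A + nc V (insert {u, v} (I \<union> X)) \<le> nc V (insert {u, v} (A \<union> X)) + nc V I"
    using IH nc_insert_connected[of "I \<union> X" u v V] nc_insert_connected[of "A \<union> X" u v V]
      nc_insert_disconnected[OF V e(2,3), of "I \<union> X"] nc_insert_disconnected[OF V e(2,3), of "A \<union> X"]
    by (cases "connects (I \<union> X) u v"; cases "connects (A \<union> X) u v") linarith+
  then show ?case by (simp add: e(1))
qed auto

lemma nc_supermodular:
  assumes V: "finite V" and "A \<subseteq> edges_in V" "B \<subseteq> edges_in V"
  shows "nc V A + nc V B \<le> nc V (A \<union> B) + nc V (A \<inter> B)"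
proof -
  have "finite B" using assms finite_edges_in finite_subset by metis
  from nc_union_diff[OF V this assms(3), of "A \<inter> B" A] show ?thesis
    by (simp add: Un_absorb1)
qed

text \<open>The extra vertices are isolated, so they add a constant to the number of clusters; in a
  probability this constant will cancel.\<close>

lemma nc_change_vertices:
  assumes V: "finite V'" "V \<subseteq> V'" and \<omega>: "\<omega> \<subseteq> edges_in V"
  shows "nc V' \<omega> + card V = nc V \<omega> + card V'"
proof -
  have fV: "finite V" using V finite_subset by blast
  then have "finite \<omega>" using \<omega> finite_edges_in finite_subset by metis
  then show ?thesis using \<omega>
  proof (induction \<omega> rule: finite_induct)
    case (insert e X)
    then obtain u v where e: "e = {u, v}" "u \<in> V" "v \<in> V" by (auto elim: edges_inE)
    then have "u \<in> V'" "v \<in> V'" using V by auto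
    moreover have "nc V' X + card V = nc V X + card V'" using insert by simp
    ultimately have "nc V' (insert {u, v} X) + card V = nc V (insert {u, v} X) + card V'"
      using nc_insert_connected[of X u v V] nc_insert_connected[of X u v V']
        nc_insert_disconnected[OF V(1), of u v X] nc_insert_disconnected[OF fV e(2,3), of X]
      by (cases "connects X u v") linarith+
    then show ?case by (simp add: e(1))
  qed (simp add: nc_empty)
qed

text \<open>At the self-dual point p / (1 - p) = sqrt q, so this is proportional to the FK weight.\<close>

definition wt :: "vert set \<Rightarrow> real \<Rightarrow> vert set set \<Rightarrow> real" where
  "wt V q \<omega> = sqrt q ^ card \<omega> * q ^ nc V \<omega>"

definition pr :: "vert set \<Rightarrow> real \<Rightarrow> vert set set \<Rightarrow> (vert set set \<Rightarrow> bool) \<Rightarrow> real" where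
  "pr V q E A = (\<Sum>\<omega>\<in>{\<omega>. \<omega> \<subseteq> E \<and> A \<omega>}. wt V q \<omega>) / (\<Sum>\<omega>\<in>Pow E. wt V q \<omega>)"

lemma wt_pos: "q > 0 \<Longrightarrow> wt V q \<omega> > 0"
  by (simp add: wt_def)

text \<open>The number of open edges is modular and the number of clusters supermodular; raising
  \<open>q \<ge> 1\<close> to the latter keeps the direction of the inequality.\<close>

lemma pr_mono:
  assumes q: "q \<ge> 1" and V: "finite V" and E: "E \<subseteq> E'" "E' \<subseteq> edges_in V"
    and inc: "\<And>A B. A \<subseteq> B \<Longrightarrow> I A \<Longrightarrow> I B"
  shows "pr V q E I \<le> pr V q E' I"
  unfolding pr_def
proof (rule supermodular_mono[OF _ E(1)])
  show fE': "finite E'" using E finite_edges_in[OF V] finite_subset by blast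
  show "wt V q A > 0" for A using q by (simp add: wt_pos)
  show "I B" if "A \<subseteq> B" "I A" for A B using that inc by blast
  fix A B assume AB: "A \<subseteq> E'" "B \<subseteq> E'"
  then have "finite A" "finite B" using fE' finite_subset by blast+
  then have c: "card A + card B = card (A \<union> B) + card (A \<inter> B)" by (rule card_Un_Int)
  have n: "nc V A + nc V B \<le> nc V (A \<union> B) + nc V (A \<inter> B)"
    by (rule nc_supermodular[OF V]) (use AB E in auto)
  have "wt V q A * wt V q B = sqrt q ^ (card A + card B) * q ^ (nc V A + nc V B)"
    by (simp add: wt_def power_add)
  also have "\<dots> \<le> sqrt q ^ (card A + card B) * q ^ (nc V (A \<union> B) + nc V (A \<inter> B))"
    using q n by (intro mult_left_mono power_increasing) auto
  also have "\<dots> = wt V q (A \<union> B) * wt V q (A \<inter> B)"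
    unfolding c by (simp add: wt_def power_add)
  finally show "wt V q A * wt V q B \<le> wt V q (A \<union> B) * wt V q (A \<inter> B)" .
qed

lemma pr_change_vertices:
  assumes q: "q > 0" and V: "finite V'" "V \<subseteq> V'" and E: "E \<subseteq> edges_in V"
  shows "pr V' q E I = pr V q E I"
proof -
  have w: "wt V' q \<omega> = q ^ (card V' - card V) * wt V q \<omega>" if "\<omega> \<subseteq> E" for \<omega>
  proof -
    have "card V \<le> card V'" using V by (rule card_mono)
    then have "nc V' \<omega> = nc V \<omega> + (card V' - card V)"
      using nc_change_vertices[OF V subset_trans[OF that E]] by linarith
    then show ?thesis by (simp add: wt_def power_add)
  qed
  have "(\<Sum>\<omega>\<in>{\<omega>. \<omega> \<subseteq> E \<and> I \<omega>}. wt V' q \<omega>)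
      = q ^ (card V' - card V) * (\<Sum>\<omega>\<in>{\<omega>. \<omega> \<subseteq> E \<and> I \<omega>}. wt V q \<omega>)"
    unfolding sum_distrib_left by (intro sum.cong) (auto simp: w)
  moreover have "(\<Sum>\<omega>\<in>Pow E. wt V' q \<omega>) = q ^ (card V' - card V) * (\<Sum>\<omega>\<in>Pow E. wt V q \<omega>)"
    unfolding sum_distrib_left by (intro sum.cong) (auto simp: w)
  ultimately show ?thesis using q by (simp add: pr_def)
qed

section \<open>Comparison with the FK measures in boxes and their limit\<close>

lemma finite_box: "finite (box n)"
  by (simp add: box_def)

lemma box_edges_eq: "box_edges n = edges_in (box n)"
  by (simp add: box_edges_def edges_in_def)

text \<open>At \<open>p_crit\<close> one has p = sqrt q (1 - p), so every weight contains the same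
  factor (1 - p)^N, with N the number of all edges, which cancels in the quotient.\<close>

lemma fk_free_prob_eq:
  assumes q: "q > 0"
  shows "fk_free_prob n (p_crit q) q A = pr (box n) q (box_edges n) A"
proof -
  define N where "N = card (box_edges n)"
  have fin: "finite (box_edges n)" unfolding box_edges_eq by (intro finite_edges_in finite_box)
  have s: "1 + sqrt q > 0" using q by (simp add: add_pos_pos)
  have w: "fk_weight n (p_crit q) q \<omega> = (1 / (1 + sqrt q)) ^ N * wt (box n) q \<omega>"
    if "\<omega> \<subseteq> box_edges n" for \<omega>
  proof -
    have le: "card \<omega> \<le> N" unfolding N_def using fin that by (rule card_mono)
    have p: "1 - p_crit q = 1 / (1 + sqrt q)" "p_crit q = sqrt q * (1 / (1 + sqrt q))"
      using s by (auto simp: p_crit_def field_simps)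
    have "p_crit q ^ card \<omega> * (1 - p_crit q) ^ (N - card \<omega>)
        = sqrt q ^ card \<omega> * (1 / (1 + sqrt q)) ^ (card \<omega> + (N - card \<omega>))"
      unfolding p(1) unfolding p(2) power_mult_distrib power_add by simp
    also have "card \<omega> + (N - card \<omega>) = N" using le by simp
    finally show ?thesis
      by (simp add: fk_weight_def wt_def num_clusters_def nc_def flip: N_def)
  qed
  have "(\<Sum>\<omega>\<in>{\<omega>. \<omega> \<subseteq> box_edges n \<and> A \<omega>}. fk_weight n (p_crit q) q \<omega>)
      = (1 / (1 + sqrt q)) ^ N * (\<Sum>\<omega>\<in>{\<omega>. \<omega> \<subseteq> box_edges n \<and> A \<omega>}. wt (box n) q \<omega>)"
    unfolding sum_distrib_left by (intro sum.cong) (auto simp: w)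
  moreover have "(\<Sum>\<omega>\<in>Pow (box_edges n). fk_weight n (p_crit q) q \<omega>)
      = (1 / (1 + sqrt q)) ^ N * (\<Sum>\<omega>\<in>Pow (box_edges n). wt (box n) q \<omega>)"
    unfolding sum_distrib_left by (intro sum.cong) (auto simp: w)
  ultimately show ?thesis using s by (simp add: fk_free_prob_def pr_def)
qed

lemma pr_le_1: assumes "q > 0" "finite E" shows "pr V q E A \<le> 1"
proof -
  have "(\<Sum>\<omega>\<in>{\<omega>. \<omega> \<subseteq> E \<and> A \<omega>}. wt V q \<omega>) \<le> (\<Sum>\<omega>\<in>Pow E. wt V q \<omega>)"
    using assms less_imp_le[OF wt_pos] by (intro sum_mono2) auto
  moreover have "(\<Sum>\<omega>\<in>Pow E. wt V q \<omega>) > 0" using assms wt_pos by (intro sum_pos) auto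
  ultimately show ?thesis by (simp add: pr_def)
qed

text \<open>With free boundary, a larger domain has larger connection probabilities. Hence the box
  probabilities increase, and being at most 1 they converge, which gives \<open>lim\<close> its
  meaning; their limit dominates each of them.\<close>

lemma phi0_connect_ge:
  assumes q: "q \<ge> 1" and V: "V \<subseteq> box n"
  shows "pr V q (edges_in V) (\<lambda>\<omega>. connects \<omega> (0, 0) x) \<le> phi0_connect (p_crit q) q x"
proof -
  let ?I = "\<lambda>\<omega>. connects \<omega> (0, 0) x"
  let ?X = "\<lambda>n. fk_free_prob n (p_crit q) q ?I"
  have X: "?X n = pr (box n) q (edges_in (box n)) ?I" for n
    using q fk_free_prob_eq[of q n] by (simp add: box_edges_eq)
  have step: "pr V q (edges_in V) ?I \<le> pr V' q (edges_in V') ?I"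
    if "V \<subseteq> V'" "finite V'" for V V'
  proof -
    \<comment> \<open>Enlarge the vertex set first, which changes nothing, and only then release the
      new edges.\<close>
    have "pr V q (edges_in V) ?I = pr V' q (edges_in V) ?I"
      using q that by (intro pr_change_vertices[symmetric]) auto
    also have "\<dots> \<le> pr V' q (edges_in V') ?I"
      using q that by (intro pr_mono edges_in_mono) (auto intro: connects_mono)
    finally show ?thesis .
  qed
  have inc: "incseq ?X" unfolding X
    by (intro incseq_SucI step finite_box) (auto simp: box_def)
  have "Bseq ?X"
  proof (rule BseqI')
    fix n
    have "pr (box n) q (edges_in (box n)) ?I \<ge> 0"
      unfolding pr_def using q less_imp_le[OF wt_pos]
      by (intro divide_nonneg_nonneg sum_nonneg) auto
    moreover have "pr (box n) q (edges_in (box n)) ?I \<le> 1"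
      using q by (intro pr_le_1 finite_edges_in finite_box) auto
    ultimately show "norm (?X n) \<le> 1" unfolding X by simp
  qed
  then have "convergent ?X" using inc by (intro Bseq_mono_convergent) (auto simp: incseq_def)
  then have "?X \<longlonglongrightarrow> phi0_connect (p_crit q) q x"
    unfolding phi0_connect_def by (simp add: convergent_LIMSEQ_iff)
  then have "?X n \<le> phi0_connect (p_crit q) q x" by (rule incseq_le[OF inc])
  then show ?thesis unfolding X using step[OF V finite_box] by linarith
qed

section \<open>Walking around clusters\<close>

text \<open>Orbits that avoid \<open>a\<close> and \<open>b\<close> are untouched, and the single
  orbit through both falls into the two orbits of \<open>a\<close> and of \<open>b\<close>.\<close>

lemma card_orbits_split:
  assumes inj: "inj f" "inj g" and fin: "finite D"
    and D: "\<And>c. c \<in> D \<Longrightarrow> f c \<in> D" "\<And>c. c \<in> D \<Longrightarrow> g c \<in> D" and ab: "a \<in> D" "b \<in> D" "a \<noteq> b"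
    and sw: "swapped f g a b" and b: "b \<in> orb f a"
  shows "card (orb g ` D) = Suc (card (orb f ` D))"
proof -
  have pf: "periodic f c" "periodic g c" if "c \<in> D" for c
    using periodic_finite[OF inj(1) fin that D(1)] periodic_finite[OF inj(2) fin that D(2)] by auto
  have U: "orb f a = orb g a \<union> orb g b" using orb_union[OF _ sw b] pf(1) ab by auto
  define R where "R = D - orb f a"
  have R: "orb g c = orb f c" if "c \<in> R" for c
  proof (rule orb_swapped_other[OF sw])
    have "orb f c \<inter> orb f a = {}"
    proof (rule ccontr)
      assume "orb f c \<inter> orb f a \<noteq> {}"
      then obtain y where "y \<in> orb f c" "y \<in> orb f a" by auto
      then have "orb f c = orb f a"
        using orb_eq[OF pf(1)[OF ab(1)], of y] orb_eq[OF pf(1), of c y] that by (auto simp: R_def)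
      then show False using that by (auto simp: R_def)
    qed
    then show "a \<notin> orb f c" "b \<notin> orb f c" using b by auto
  qed
  have sub: "orb f a \<subseteq> D" by (rule orb_least[OF ab(1) D(1)])
  have 1: "orb f ` D = insert (orb f a) (orb f ` R)"
  proof
    show "orb f ` D \<subseteq> insert (orb f a) (orb f ` R)"
    proof
      fix y assume "y \<in> orb f ` D"
      then obtain c where c: "c \<in> D" "y = orb f c" by auto
      show "y \<in> insert (orb f a) (orb f ` R)"
        using orb_eq[OF pf(1)[OF ab(1)], of c] c by (cases "c \<in> orb f a") (auto simp: R_def)
    qed
    show "insert (orb f a) (orb f ` R) \<subseteq> orb f ` D" using ab by (auto simp: R_def)
  qed
  have ga: "orb g c = orb g a \<or> orb g c = orb g b" if "c \<in> orb f a" for c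
    using that U orb_eq[OF pf(2)[OF ab(1)], of c] orb_eq[OF pf(2)[OF ab(2)], of c] by auto
  have 2: "orb g ` D = insert (orb g a) (insert (orb g b) (orb f ` R))"
  proof
    show "orb g ` D \<subseteq> insert (orb g a) (insert (orb g b) (orb f ` R))"
    proof
      fix y assume "y \<in> orb g ` D"
      then obtain c where c: "c \<in> D" "y = orb g c" by auto
      show "y \<in> insert (orb g a) (insert (orb g b) (orb f ` R))"
        using ga[of c] R[of c] c by (cases "c \<in> orb f a") (auto simp: R_def)
    qed
    have "orb f c \<in> orb g ` D" if "c \<in> R" for c
      using R[OF that] that by (metis DiffD1 R_def image_eqI)
    then show "insert (orb g a) (insert (orb g b) (orb f ` R)) \<subseteq> orb g ` D" using ab by auto
  qed
  have n: "X \<notin> orb f ` R" if "X \<subseteq> orb f a" for X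
  proof
    assume "X \<in> orb f ` R"
    then obtain c where "c \<in> R" "X = orb f c" by auto
    then have "c \<in> X" "c \<notin> orb f a" by (auto simp: R_def)
    then show False using that by auto
  qed
  have "b \<notin> orb g a" using split_or_merge[OF inj(1) pf(1)[OF ab(1)] b ab(3) sw] .
  then have "orb g a \<noteq> orb g b" by auto
  moreover have "finite R" using fin by (simp add: R_def)
  moreover have "orb f a \<notin> orb f ` R" "orb g a \<notin> orb f ` R" "orb g b \<notin> orb f ` R"
    using n U by auto
  ultimately show ?thesis unfolding 1 2 by simp
qed

text \<open>If the orbit of \<open>r\<close> meets both points, the exchange cuts a loop out of it.
  If it meets exactly one, the exchange inserts the orbit of the other, and the same surgery is read
  backwards, from \<open>g\<close> to \<open>f\<close>. The order of the visits gives two variants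
  of each.\<close>

lemma surgery_cases:
  assumes inj: "inj f" "inj g" and pf: "\<And>c. c \<in> {a, b, r} \<Longrightarrow> periodic f c" and pg: "periodic g r"
    and sw: "swapped f g a b" and ab: "a \<noteq> b"
  obtains "a \<notin> orb f r" "b \<notin> orb f r"
    | i j where "surgery f g a b r i j" | i j where "surgery f g b a r i j"
    | i j where "surgery g f a b r i j" | i j where "surgery g f b a r i j"
proof -
  have pr: "periodic f r" using pf by simp
  \<comment> \<open>The two orbits agree until \<open>a\<close> is reached, and \<open>b\<close> can
    therefore be met under \<open>g\<close> only later; this fixes the order
    \<open>i < j\<close>.\<close>
  have half: "\<exists>i j. surgery g f a b r i j"
    if a: "a \<in> orb f r" and b: "b \<notin> orb f r" and sw: "swapped f g a b" and pb: "periodic f b" for a b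
  proof -
    obtain i where i: "i < per f r" "a = (f ^^ i) r" by (rule orb_obtain[OF pr a])
    have pre: "(g ^^ k) r = (f ^^ k) r" if "k \<le> i" for k
      using that
    proof (induction k)
      case (Suc k)
      have "(f ^^ k) r \<noteq> a" using funpow_inj_per[OF inj(1), of k r i] Suc.prems i(1) unfolding i(2) by linarith
      moreover have "(f ^^ k) r \<noteq> b" using b orb_funpow by metis
      ultimately show ?case using Suc sw by (simp add: swapped_def)
    qed simp
    then have ag: "a = (g ^^ i) r" using i by simp
    then have ag': "a \<in> orb g r" by auto
    have "a \<notin> orb f b"
      using orb_sym[OF pb, of a] orb_mono[OF a] b by auto
    then have "b \<in> orb g a" by (rule merge_reaches[OF inj(1) pb _ sw])
    then have "b \<in> orb g r" using orb_mono[OF ag'] by auto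
    then obtain j where j: "j < per g r" "b = (g ^^ j) r" using orb_obtain[OF pg] by metis
    have "i < j"
    proof (rule ccontr)
      assume "\<not> i < j"
      then have "b = (f ^^ j) r" using pre[of j] j by simp
      then show False using b orb_funpow by metis
    qed
    then have "surgery g f a b r i j"
      using inj pg swapped_sym[OF sw] j ag by unfold_locales auto
    then show ?thesis by blast
  qed
  consider "a \<notin> orb f r" "b \<notin> orb f r" | "a \<in> orb f r" "b \<notin> orb f r"
    | "a \<notin> orb f r" "b \<in> orb f r" | "a \<in> orb f r" "b \<in> orb f r" by blast
  then show thesis
  proof cases
    case 2
    then show ?thesis using half[OF _ _ sw pf] that by blast
  next
    case 3
    then show ?thesis using half[OF _ _ swapped_commute[OF sw] pf] that by blast
  next
    case 4
    obtain i where i: "i < per f r" "a = (f ^^ i) r" by (rule orb_obtain[OF pr 4(1)])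
    obtain j where j: "j < per f r" "b = (f ^^ j) r" by (rule orb_obtain[OF pr 4(2)])
    have "i \<noteq> j" using ab i j by auto
    then consider "i < j" | "j < i" by linarith
    then show ?thesis
    proof cases
      case 1
      then have "surgery f g a b r i j" using inj pf sw i j by unfold_locales auto
      then show ?thesis by (rule that)
    next
      case 2
      then have "surgery f g b a r j i"
        using inj pf swapped_commute[OF sw] i j by unfold_locales auto
      then show ?thesis by (rule that)
    qed
  qed (rule that)
qed

section \<open>The walk around clusters as a permutation of darts\<close>

type_synonym dart = "vert \<times> vert"

fun rot :: "vert \<Rightarrow> vert" where "rot (x, y) = (- y, x)"
fun irot :: "vert \<Rightarrow> vert" where "irot (x, y) = (y, - x)"

text \<open>A dart (v, d) stands for the corner at v just clockwise of the half-edge in direction d.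
  Walking around clusters with the cluster on the left, one meets that half-edge next: if it is
  open one follows it and turns right, otherwise one stays at v and turns left.\<close>

definition is_open :: "vert set set \<Rightarrow> dart \<Rightarrow> bool" where
  "is_open \<omega> c \<longleftrightarrow> {fst c, fst c + snd c} \<in> \<omega>"

definition nxt :: "vert set set \<Rightarrow> dart \<Rightarrow> dart" where
  "nxt \<omega> c = (if is_open \<omega> c then (fst c + snd c, irot (snd c)) else (fst c, rot (snd c)))"

definition turn :: "vert set set \<Rightarrow> dart \<Rightarrow> int" where
  "turn \<omega> c = (if is_open \<omega> c then -1 else 1)"

definition dirs :: "vert set" where
  "dirs = {(1, 0), (0, 1), (-1, 0), (0, -1)}"

text \<open>The same edge seen from its other endpoint. A dart and its opposite are the only two
  whose successors depend on that edge.\<close>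

definition opp :: "dart \<Rightarrow> dart" where
  "opp c = (fst c + snd c, - snd c)"

lemma rot_simps [simp]: "rot (irot d) = d" "irot (rot d) = d" "irot (- d) = rot d" "rot (- d) = irot d"
    "irot (irot d) = - d" "rot (rot d) = - d" "irot d + rot d = 0" "rot d + irot d = 0"
  by (cases d; simp add: zero_prod_def)+

lemma dirs_rot [simp]: "d \<in> dirs \<Longrightarrow> rot d \<in> dirs" "d \<in> dirs \<Longrightarrow> irot d \<in> dirs" "d \<in> dirs \<Longrightarrow> - d \<in> dirs"
  by (auto simp: dirs_def)

lemma finite_dirs [simp]: "finite dirs" and card_dirs: "card dirs = 4"
  by (auto simp: dirs_def)

lemma dirs_nonzero: "d \<in> dirs \<Longrightarrow> d \<noteq> 0"
  by (auto simp: dirs_def zero_prod_def)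

lemma dirs_orbit:
  assumes "d \<in> dirs" shows "dirs = {d, rot d, - d, irot d}" "distinct [d, irot d, - d, rot d]"
  using assms by (auto simp: dirs_def)

declare rot.simps [simp del] irot.simps [simp del]

lemma adjacent_dirs: "adjacent v (v + d) \<longleftrightarrow> d \<in> dirs"
proof -
  have "adjacent v (v + d) \<longleftrightarrow> \<bar>fst d\<bar> + \<bar>snd d\<bar> = 1" by (simp add: adjacent_def)
  also have "\<dots> \<longleftrightarrow> d \<in> dirs"
  proof
    assume "\<bar>fst d\<bar> + \<bar>snd d\<bar> = 1"
    then have "(\<bar>fst d\<bar> = 1 \<and> snd d = 0) \<or> (fst d = 0 \<and> \<bar>snd d\<bar> = 1)" by linarith
    then show "d \<in> dirs" by (cases d) (auto simp: dirs_def)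
  qed (auto simp: dirs_def)
  finally show ?thesis .
qed

lemma opp_opp [simp]: "opp (opp c) = c" by (simp add: opp_def)

lemma opp_neq: "snd c \<noteq> 0 \<Longrightarrow> opp c \<noteq> c"
  by (cases c) (auto simp: opp_def)

lemma is_open_opp [simp]: "is_open \<omega> (opp c) = is_open \<omega> c"
  by (simp add: is_open_def opp_def insert_commute)

lemma edge_eq_iff:
  "{fst c', fst c' + snd c'} = {fst c, fst c + snd c} \<longleftrightarrow> c' = c \<or> c' = opp (c :: dart)"
proof
  assume "{fst c', fst c' + snd c'} = {fst c, fst c + snd c}"
  then have "(fst c' = fst c \<and> fst c' + snd c' = fst c + snd c) \<or>
    (fst c' = fst c + snd c \<and> fst c' + snd c' = fst c)" unfolding doubleton_eq_iff by blast
  then show "c' = c \<or> c' = opp c"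
  proof
    assume "fst c' = fst c + snd c \<and> fst c' + snd c' = fst c"
    then have "fst c' = fst c + snd c" "snd c' = - snd c"
      by (auto simp: eq_neg_iff_add_eq_0 algebra_simps)
    then show ?thesis by (simp add: opp_def prod_eq_iff)
  qed (simp add: prod_eq_iff)
qed (auto simp: opp_def)

lemma is_open_insert:
  "is_open (insert {fst c, fst c + snd c} \<omega>) c' \<longleftrightarrow> c' = c \<or> c' = opp c \<or> is_open \<omega> c'"
  unfolding is_open_def insert_iff edge_eq_iff by blast

text \<open>A collision between an open and a closed dart would make them opposite to each other;
  but opposite darts share their edge, so they are both open or both closed.\<close>

lemma inj_nxt: "inj (nxt \<omega>)"
proof (rule injI)
  fix c c' :: dart assume e: "nxt \<omega> c = nxt \<omega> c'"
  obtain v d v' d' where c: "c = (v, d)" "c' = (v', d')" by (metis surj_pair)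
  have i: "irot x = irot y \<Longrightarrow> x = y" "rot x = rot y \<Longrightarrow> x = y" for x y
    by (cases x; cases y; simp add: rot.simps irot.simps)+
  have ri: "rot x = irot y \<Longrightarrow> x = - y" for x y
    by (cases x; cases y; simp add: rot.simps irot.simps)
  show "c = c'"
  proof (cases "is_open \<omega> c"; cases "is_open \<omega> c'")
    assume "is_open \<omega> c" "is_open \<omega> c'"
    then show ?thesis using e by (auto simp: nxt_def c dest: i)
  next
    assume o: "is_open \<omega> c" "\<not> is_open \<omega> c'"
    then have "v' = v + d" "d' = - d" using e by (auto simp: nxt_def c dest: sym[THEN ri])
    then have "c' = opp c" by (simp add: c opp_def)
    then show ?thesis using o by simp
  next
    assume o: "\<not> is_open \<omega> c" "is_open \<omega> c'"
    then have "v = v' + d'" "d = - d'" using e by (auto simp: nxt_def c dest: ri)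
    then have "c = opp c'" by (simp add: c opp_def)
    then show ?thesis using o by simp
  next
    assume "\<not> is_open \<omega> c" "\<not> is_open \<omega> c'"
    then show ?thesis using e by (auto simp: nxt_def c dest: i)
  qed
qed

text \<open>Because \<open>rot (- d) = irot d\<close>, crossing the open edge and turning right
  leads to the dart that the opposite side reaches by staying and turning left.\<close>

lemma swapped_nxt:
  assumes "\<not> is_open \<omega> c"
  shows "swapped (nxt \<omega>) (nxt (insert {fst c, fst c + snd c} \<omega>)) c (opp c)"
proof -
  have "is_open (insert {fst c, fst c + snd c} \<omega>) c" by (simp add: is_open_insert)
  moreover have "\<not> is_open \<omega> (opp c)" using assms by simp
  ultimately show ?thesis using assms
    unfolding swapped_def nxt_def is_open_insert by (auto simp: opp_def)
qed

lemma turn_insert_other: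
  "c' \<noteq> c \<Longrightarrow> c' \<noteq> opp c \<Longrightarrow> turn (insert {fst c, fst c + snd c} \<omega>) c' = turn \<omega> c'"
  by (simp add: turn_def is_open_insert)

lemma turn_insert_same:
  "turn (insert {fst c, fst c + snd c} \<omega>) c = -1" "turn (insert {fst c, fst c + snd c} \<omega>) (opp c) = -1"
  by (simp_all add: turn_def is_open_insert)

lemma sum_turn_insert:
  assumes X: "finite X" "c \<in> X" "opp c \<in> X" "c \<noteq> opp c" and no: "\<not> is_open \<omega> c"
  shows "sum (turn \<omega>) X = sum (turn (insert {fst c, fst c + snd c} \<omega>)) X + 4"
proof -
  let ?\<omega>' = "insert {fst c, fst c + snd c} \<omega>"
  have "sum (turn \<omega>) X - sum (turn ?\<omega>') X = (\<Sum>x\<in>X. turn \<omega> x - turn ?\<omega>' x)"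
    by (simp add: sum_subtractf)
  also have "\<dots> = (\<Sum>x\<in>{c, opp c}. turn \<omega> x - turn ?\<omega>' x)"
    using X turn_insert_other[of _ c \<omega>] by (intro sum.mono_neutral_right) auto
  also have "\<dots> = (\<Sum>x\<in>{c, opp c}. 2)"
    using no turn_insert_same[of c \<omega>] by (intro sum.cong) (auto simp: turn_def[of \<omega>])
  also have "\<dots> = 4" using X by simp
  finally show ?thesis by simp
qed

lemma orb_connected:
  fixes c c' :: dart
  shows "c' \<in> orb (nxt \<omega>) c \<Longrightarrow> connects \<omega> (fst c) (fst c')"
proof -
  have "orb (nxt \<omega>) c \<subseteq> {c'. connects \<omega> (fst c) (fst c')}"
  proof (rule orb_least)
    fix y :: dart assume "y \<in> {c'. connects \<omega> (fst c) (fst c')}"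
    moreover have "connects \<omega> (fst y) (fst (nxt \<omega> y))"
      by (auto simp: nxt_def is_open_def intro: connects_edge)
    ultimately show "nxt \<omega> y \<in> {c'. connects \<omega> (fst c) (fst c')}" using connects_trans by blast
  qed auto
  then show "c' \<in> orb (nxt \<omega>) c \<Longrightarrow> connects \<omega> (fst c) (fst c')" by auto
qed

text \<open>With right turns only, the walk closes after four steps around one unit face.\<close>

lemma orb_unit_square:
  fixes c :: dart
  assumes o: "\<And>c'. c' \<in> orb (nxt \<omega>) c \<Longrightarrow> is_open \<omega> c'" and d: "snd c \<in> dirs"
  shows "sum (turn \<omega>) (orb (nxt \<omega>) c) = -4"
proof -
  obtain v d where c: "c = (v, d)" by (metis surj_pair)
  let ?c1 = "(v + d, irot d)" and ?c2 = "(v + d + irot d, - d)" and ?c3 = "(v + irot d, rot d)"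
  have m: "y \<in> orb (nxt \<omega>) c \<Longrightarrow> nxt \<omega> y = (fst y + snd y, irot (snd y))" for y :: dart
    using o by (simp add: nxt_def)
  have n0: "nxt \<omega> c = ?c1" using m[OF orb_self] by (simp add: c)
  then have m1: "?c1 \<in> orb (nxt \<omega>) c" using orb_step[OF orb_self, of "nxt \<omega>" c] by simp
  then have n1: "nxt \<omega> ?c1 = ?c2" using m[OF m1] by simp
  then have m2: "?c2 \<in> orb (nxt \<omega>) c" using orb_step[OF m1] by simp
  then have n2: "nxt \<omega> ?c2 = ?c3" using m[OF m2] by simp
  then have m3: "?c3 \<in> orb (nxt \<omega>) c" using orb_step[OF m2] by simp
  then have n3: "nxt \<omega> ?c3 = c" using m[OF m3] by (simp add: c add.assoc)
  have "orb (nxt \<omega>) c \<subseteq> {c, ?c1, ?c2, ?c3}"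
    by (rule orb_least) (use n0 n1 n2 n3 in auto)
  then have O: "orb (nxt \<omega>) c = {c, ?c1, ?c2, ?c3}" using m1 m2 m3 by auto
  have "sum (turn \<omega>) (orb (nxt \<omega>) c) = (\<Sum>y\<in>{c, ?c1, ?c2, ?c3}. -1)"
    using o unfolding O by (intro sum.cong) (auto simp: turn_def)
  also have "\<dots> = -4" using dirs_orbit(2)[of d] d by (auto simp: c)
  finally show ?thesis .
qed

lemma orb_isolated:
  assumes o: "\<And>d. d \<in> dirs \<Longrightarrow> \<not> is_open \<omega> (v, d)" and d: "d \<in> dirs"
  shows "orb (nxt \<omega>) (v, d) = {v} \<times> dirs" "sum (turn \<omega>) (orb (nxt \<omega>) (v, d)) = 4"
proof -
  have n: "nxt \<omega> (v, d) = (v, rot d)" if "d \<in> dirs" for d using o[OF that] by (simp add: nxt_def)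
  have 1: "orb (nxt \<omega>) (v, d) \<subseteq> {v} \<times> dirs"
  proof (rule orb_least)
    fix y assume "y \<in> {v} \<times> dirs"
    then show "nxt \<omega> y \<in> {v} \<times> dirs" using n[of "snd y"] by (cases y) (simp del: rot.simps)
  qed (use d in simp)
  have m1: "(v, rot d) \<in> orb (nxt \<omega>) (v, d)" using orb_step[OF orb_self, of "nxt \<omega>" "(v, d)"] n d by simp
  have m2: "(v, - d) \<in> orb (nxt \<omega>) (v, d)" using orb_step[OF m1] n d by simp
  have m3: "(v, irot d) \<in> orb (nxt \<omega>) (v, d)" using orb_step[OF m2] n d by simp
  show O: "orb (nxt \<omega>) (v, d) = {v} \<times> dirs"
    using 1 m1 m2 m3 dirs_orbit(1)[OF d] by auto
  have "sum (turn \<omega>) (orb (nxt \<omega>) (v, d)) = (\<Sum>y\<in>{v} \<times> dirs. 1)"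
    unfolding O using o by (intro sum.cong) (auto simp: turn_def)
  then show "sum (turn \<omega>) (orb (nxt \<omega>) (v, d)) = 4" by (simp add: card_cartesian_product card_dirs)
qed

section \<open>Simply connected domains\<close>

text \<open>The last two assumptions express simple connectedness: in the full configuration a single orbit
  of total turning 4 runs along the whole boundary. The dart r0 is the last one of the tour, which
  starts with its successor, called r below.\<close>

locale sc_domain =
  fixes V :: "vert set" and r0 :: dart
  assumes fin: "finite V"
    and connected: "u \<in> V \<Longrightarrow> v \<in> V \<Longrightarrow> connects (edges_in V) u v"
    and r0: "fst r0 \<in> V" "snd r0 \<in> dirs" "fst r0 + snd r0 \<notin> V"
    and tour: "c \<in> V \<times> dirs \<Longrightarrow> fst c + snd c \<notin> V \<Longrightarrow> c \<in> orb (nxt (edges_in V)) (fst r0, rot (snd r0))"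
    and tour_turn: "sum (turn (edges_in V)) (orb (nxt (edges_in V)) (fst r0, rot (snd r0))) = 4"
begin

definition "D = V \<times> dirs"
definition "E = edges_in V"
definition "ext = {c \<in> D. fst c + snd c \<notin> V}"
definition "r = (fst r0, rot (snd r0))"
definition "origin = fst r0"

lemma finE: "finite E" unfolding E_def by (rule finite_edges_in[OF fin])
lemma finD: "finite D" unfolding D_def using fin by simp
lemma finite_sub: "\<omega> \<subseteq> E \<Longrightarrow> finite \<omega>" using finE finite_subset by blast

lemma r_in: "r \<in> D" using r0 by (simp add: r_def D_def)
lemma r0_ext: "r0 \<in> ext" using r0 by (simp add: ext_def D_def mem_Times_iff)
lemma fst_r: "fst r = origin" by (simp add: r_def origin_def)

lemma edge_of_dart: "c \<in> D \<Longrightarrow> {fst c, fst c + snd c} \<in> E \<longleftrightarrow> c \<notin> ext"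
proof -
  assume c: "c \<in> D"
  have "{fst c, fst c + snd c} \<in> E \<longleftrightarrow> fst c + snd c \<in> V"
  proof
    assume "{fst c, fst c + snd c} \<in> E"
    then show "fst c + snd c \<in> V" unfolding E_def by (elim edges_inE) (auto simp: doubleton_eq_iff)
  next
    assume "fst c + snd c \<in> V"
    moreover have "fst c \<in> V" "adjacent (fst c) (fst c + snd c)"
      using c by (auto simp: D_def adjacent_dirs mem_Times_iff)
    ultimately show "{fst c, fst c + snd c} \<in> E" unfolding E_def edges_in_def by blast
  qed
  then show ?thesis using c by (simp add: ext_def)
qed

lemma dart_of_edge:
  assumes "e \<in> E"
  obtains c where "e = {fst c, fst c + snd c}" "c \<in> D" "opp c \<in> D" "c \<noteq> opp c" "c \<notin> ext" "opp c \<notin> ext"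
    "fst c \<in> V" "fst c + snd c \<in> V"
proof -
  obtain u v where e: "e = {u, v}" "u \<in> V" "v \<in> V" "adjacent u v"
    using assms unfolding E_def by (rule edges_inE)
  define c where "c = (u, v - u)"
  have "v - u \<in> dirs" using e(4) adjacent_dirs[of u "v - u"] by simp
  then have 1: "e = {fst c, fst c + snd c}" "c \<in> D" "opp c \<in> D" "c \<noteq> opp c"
    using e opp_neq[of c] dirs_nonzero[of "v - u"] dirs_rot(3)[of "v - u"]
    by (auto simp: c_def D_def opp_def)
  moreover have "c \<notin> ext" "opp c \<notin> ext" "fst c \<in> V" "fst c + snd c \<in> V"
    using e by (auto simp: ext_def c_def opp_def)
  ultimately show thesis by (intro that)
qed

lemma not_open_ext: "\<omega> \<subseteq> E \<Longrightarrow> c \<in> ext \<Longrightarrow> \<not> is_open \<omega> c"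
  using edge_of_dart[of c] by (auto simp: ext_def is_open_def)

lemma nxt_D: assumes "\<omega> \<subseteq> E" "c \<in> D" shows "nxt \<omega> c \<in> D"
proof (cases "is_open \<omega> c")
  case True
  then have "c \<notin> ext" using not_open_ext assms by blast
  then have "fst c + snd c \<in> V" using assms by (simp add: ext_def)
  then show ?thesis using assms True by (simp add: nxt_def D_def mem_Times_iff)
next
  case False
  then show ?thesis using assms by (simp add: nxt_def D_def mem_Times_iff)
qed

lemma periodic_nxt: "\<omega> \<subseteq> E \<Longrightarrow> c \<in> D \<Longrightarrow> periodic (nxt \<omega>) c"
  using periodic_finite[OF inj_nxt finD] nxt_D by blast

lemma orb_D: "\<omega> \<subseteq> E \<Longrightarrow> c \<in> D \<Longrightarrow> orb (nxt \<omega>) c \<subseteq> D"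
  using nxt_D by (intro orb_least) auto

lemma orb_disjoint:
  assumes "\<omega> \<subseteq> E" "c \<in> D" "c' \<in> D" "c' \<notin> orb (nxt \<omega>) c"
  shows "orb (nxt \<omega>) c \<inter> orb (nxt \<omega>) c' = {}"
proof (rule ccontr)
  assume "\<not> ?thesis"
  then obtain y where "y \<in> orb (nxt \<omega>) c" "y \<in> orb (nxt \<omega>) c'" by auto
  then have "orb (nxt \<omega>) c = orb (nxt \<omega>) c'"
    using orb_eq periodic_nxt assms by metis
  then show False using assms orb_self by metis
qed

lemma nxt_r0: "\<omega> \<subseteq> E \<Longrightarrow> nxt \<omega> r0 = r"
  using not_open_ext[OF _ r0_ext] by (simp add: nxt_def r_def)

lemma r0_in_orb: assumes "\<omega> \<subseteq> E" shows "r0 \<in> orb (nxt \<omega>) r"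
proof -
  have "r0 \<in> D" using r0_ext by (simp add: ext_def)
  moreover have "r \<in> orb (nxt \<omega>) r0" using orb_step[OF orb_self, of "nxt \<omega>" r0] nxt_r0[OF assms] by simp
  ultimately show ?thesis using orb_sym periodic_nxt assms by metis
qed

abbreviation "orbit_count \<omega> \<equiv> card (orb (nxt \<omega>) ` D)"

text \<open>Opening an edge never increases this quantity, and strictly decreases it if the endpoints are
  already connected but the two sides of the edge lie on different orbits. As it vanishes for both
  the empty and the full configuration, it vanishes always and the second case never occurs.\<close>

definition euler :: "vert set set \<Rightarrow> int" where
  "euler \<omega> = int (orbit_count \<omega>) + int (card V) - int (card \<omega>) - 2 * int (nc V \<omega>)"

text \<open>Opening the edge adds an orbit if both sides lie on one orbit and removes one otherwise;
  the number of clusters drops by one exactly if the endpoints were disconnected. Since an orbit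
  stays in one cluster, the remaining cases change \<open>euler\<close> by 0, 0 and -2; the last is
  the case of connected endpoints and different orbits.\<close>

lemma euler_insert:
  assumes \<omega>: "insert e \<omega> \<subseteq> E" "e \<notin> \<omega>" and e: "e = {fst c, fst c + snd c}" and c: "c \<in> D"
  shows "euler (insert e \<omega>) \<le> euler \<omega>"
    and "connects \<omega> (fst c) (fst c + snd c) \<Longrightarrow> opp c \<notin> orb (nxt \<omega>) c \<Longrightarrow> euler (insert e \<omega>) < euler \<omega>"
proof -
  let ?\<omega>' = "insert e \<omega>"
  have cE: "c \<notin> ext" using edge_of_dart[OF c] \<omega> e by auto
  then have V: "fst c \<in> V" "fst c + snd c \<in> V" using c by (auto simp: ext_def D_def)
  have oD: "opp c \<in> D" "c \<noteq> opp c" using c V opp_neq[of c] dirs_nonzero[of "snd c"]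
    by (auto simp: D_def opp_def mem_Times_iff)
  have fw: "finite \<omega>" using \<omega> finite_sub by auto
  have no: "\<not> is_open \<omega> c" using \<omega> e by (simp add: is_open_def)
  have sw: "swapped (nxt \<omega>) (nxt ?\<omega>') c (opp c)" unfolding e by (rule swapped_nxt[OF no])
  have w: "\<omega> \<subseteq> E" "?\<omega>' \<subseteq> E" using \<omega> by auto
  have same: "orbit_count ?\<omega>' = Suc (orbit_count \<omega>)" if "opp c \<in> orb (nxt \<omega>) c"
    using nxt_D w by (intro card_orbits_split[OF inj_nxt inj_nxt finD _ _ c oD sw that]) auto
  have diff: "orbit_count \<omega> = Suc (orbit_count ?\<omega>')" if "opp c \<notin> orb (nxt \<omega>) c"
  proof -
    have "c \<notin> orb (nxt \<omega>) (opp c)" using that orb_sym periodic_nxt w oD by metis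
    then have "opp c \<in> orb (nxt ?\<omega>') c"
      by (rule merge_reaches[OF inj_nxt periodic_nxt[OF w(1) oD(1)] _ sw])
    then show ?thesis
      using nxt_D w by (intro card_orbits_split[OF inj_nxt inj_nxt finD _ _ c oD swapped_sym[OF sw]]) auto
  qed
  have cd: "card ?\<omega>' = Suc (card \<omega>)" using fw \<omega> by simp
  have nc1: "nc V ?\<omega>' = nc V \<omega>" if "connects \<omega> (fst c) (fst c + snd c)"
    unfolding e by (rule nc_insert_connected[OF that])
  have nc2: "nc V \<omega> = Suc (nc V ?\<omega>')" if "\<not> connects \<omega> (fst c) (fst c + snd c)"
    unfolding e by (rule nc_insert_disconnected[OF fin V that])
  have "connects \<omega> (fst c) (fst c + snd c)" if "opp c \<in> orb (nxt \<omega>) c"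
    using orb_connected[OF that] by (simp add: opp_def)
  then show "euler ?\<omega>' \<le> euler \<omega>"
    using same diff cd nc1 nc2 unfolding euler_def
    by (cases "opp c \<in> orb (nxt \<omega>) c"; cases "connects \<omega> (fst c) (fst c + snd c)") linarith+
  show "euler ?\<omega>' < euler \<omega>"
    if "connects \<omega> (fst c) (fst c + snd c)" "opp c \<notin> orb (nxt \<omega>) c"
    using diff[OF that(2)] cd nc1[OF that(1)] unfolding euler_def by simp
qed

lemma remove_edges_induct [consumes 1, case_names full remove]:
  assumes "\<omega> \<subseteq> E" "P E"
    and step: "\<And>e \<omega>. insert e \<omega> \<subseteq> E \<Longrightarrow> e \<notin> \<omega> \<Longrightarrow> P (insert e \<omega>) \<Longrightarrow> P \<omega>"
  shows "P \<omega>"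
  using assms(1)
proof (induction "card (E - \<omega>)" arbitrary: \<omega>)
  case 0
  then have "\<omega> = E" using finE by auto
  then show ?case using assms(2) by simp
next
  case (Suc k)
  then have "E - \<omega> \<noteq> {}" by (metis card.empty nat.distinct(1))
  then obtain e where e: "e \<in> E" "e \<notin> \<omega>" by auto
  have "E - insert e \<omega> = (E - \<omega>) - {e}" by auto
  then have "card (E - insert e \<omega>) = k" using Suc(2) e finE by simp
  then have "P (insert e \<omega>)" using Suc(1)[of "insert e \<omega>"] Suc(3) e by auto
  then show ?case using step[of e \<omega>] Suc(3) e by auto
qed

lemma euler_step: assumes "insert e \<omega> \<subseteq> E" "e \<notin> \<omega>" shows "euler (insert e \<omega>) \<le> euler \<omega>"
proof -
  have "e \<in> E" using assms by simp
  then obtain c where "e = {fst c, fst c + snd c}" "c \<in> D" by (rule dart_of_edge)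
  then show ?thesis by (rule euler_insert(1)[OF assms])
qed

lemma euler_E_le: "\<omega> \<subseteq> E \<Longrightarrow> euler E \<le> euler \<omega>"
proof (induction \<omega> rule: remove_edges_induct)
  case (remove e \<omega>)
  then show ?case using euler_step[of e \<omega>] by linarith
qed simp

lemma euler_le_empty: assumes "\<omega> \<subseteq> E" shows "euler \<omega> \<le> euler {}"
  using finite_sub[OF assms] assms
proof (induction \<omega> rule: finite_induct)
  case (insert e \<omega>)
  then show ?case using euler_step[of e \<omega>] by auto
qed simp

lemma euler_empty: "euler {} = 0"
proof -
  have o: "orb (nxt {}) c = {fst c} \<times> dirs" if "c \<in> D" for c
    using that orb_isolated(1)[of "{}" "fst c" "snd c"] by (auto simp: D_def is_open_def)
  have "orb (nxt {}) ` D = (\<lambda>v. {v} \<times> dirs) ` V"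
  proof -
    have "orb (nxt {}) ` D = (\<lambda>c. {fst c} \<times> dirs) ` D" using o by (intro image_cong) auto
    also have "\<dots> = (\<lambda>v. {v} \<times> dirs) ` fst ` D" by (simp add: image_image)
    also have "fst ` D = V" by (auto simp: D_def dirs_def image_iff)
    finally show ?thesis .
  qed
  moreover have "inj_on (\<lambda>v. {v} \<times> dirs) V"
    using card_dirs by (intro inj_onI) (metis card.empty times_eq_iff singleton_inject insert_not_empty zero_neq_numeral)
  ultimately have "orbit_count {} = card V" by (simp add: card_image)
  then show ?thesis by (simp add: euler_def nc_empty)
qed

section \<open>Total turning and Euler's formula\<close>

lemma sum_turn: assumes "\<omega> \<subseteq> E" shows "sum (turn \<omega>) D = 4 * int (card V) - 4 * int (card \<omega>)"
  using finite_sub[OF assms] assms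
proof (induction \<omega> rule: finite_induct)
  case empty
  have "sum (turn {}) D = (\<Sum>c\<in>D. 1)" by (intro sum.cong) (auto simp: turn_def is_open_def)
  then show ?case by (simp add: D_def card_cartesian_product card_dirs)
next
  case (insert e \<omega>)
  then have "e \<in> E" by simp
  then obtain c where c: "e = {fst c, fst c + snd c}" "c \<in> D" "opp c \<in> D" "c \<noteq> opp c"
    by (rule dart_of_edge)
  have no: "\<not> is_open \<omega> c" using insert c by (simp add: is_open_def)
  have "sum (turn \<omega>) D = sum (turn (insert e \<omega>)) D + 4"
    unfolding c(1) using finD c no by (intro sum_turn_insert) auto
  then show ?case using insert by simp
qed

lemma sum_orbits:
  fixes t :: "dart \<Rightarrow> int"
  assumes "\<omega> \<subseteq> E" shows "sum t D = (\<Sum>X\<in>orb (nxt \<omega>) ` D. sum t X)"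
proof -
  have U: "\<Union> (orb (nxt \<omega>) ` D) = D" using orb_D[OF assms] orb_self by blast
  have "sum t (\<Union> (orb (nxt \<omega>) ` D)) = (\<Sum>X\<in>orb (nxt \<omega>) ` D. sum t X)"
  proof (subst sum.Union_disjoint)
    show "\<forall>A\<in>orb (nxt \<omega>) ` D. finite A"
      using finite_orb[OF periodic_nxt[OF assms]] by blast
    show "\<forall>A\<in>orb (nxt \<omega>) ` D. \<forall>B\<in>orb (nxt \<omega>) ` D. A \<noteq> B \<longrightarrow> A \<inter> B = {}"
    proof (intro ballI impI)
      fix A B assume "A \<in> orb (nxt \<omega>) ` D" "B \<in> orb (nxt \<omega>) ` D" "A \<noteq> B"
      then obtain c c' where c: "c \<in> D" "c' \<in> D" "A = orb (nxt \<omega>) c" "B = orb (nxt \<omega>) c'" by blast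
      then have "c' \<notin> orb (nxt \<omega>) c" using \<open>A \<noteq> B\<close> orb_eq periodic_nxt[OF assms] by metis
      then show "A \<inter> B = {}" using orb_disjoint[OF assms] c by auto
    qed
  qed simp
  then show ?thesis unfolding U .
qed

lemma ext_orb_E: "ext \<subseteq> orb (nxt E) r"
  using tour by (auto simp: ext_def D_def E_def r_def)

lemma turn_orb_E: "sum (turn E) (orb (nxt E) r) = 4"
  using tour_turn by (simp add: E_def r_def)

text \<open>All boundary darts are on the orbit of \<open>r\<close>, so any other orbit crosses only
  open edges and surrounds a single face.\<close>

lemma turn_orb_E_other: assumes "c \<in> D" "c \<notin> orb (nxt E) r" shows "sum (turn E) (orb (nxt E) c) = -4"
proof (rule orb_unit_square)
  show "snd c \<in> dirs" using assms by (auto simp: D_def)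
  fix c' assume c': "c' \<in> orb (nxt E) c"
  then have "c' \<in> D" using orb_D[of E c] assms by auto
  moreover have "c' \<notin> ext" using orb_disjoint[of E r c] assms r_in c' ext_orb_E by auto
  ultimately show "is_open E c'" using edge_of_dart by (simp add: is_open_def)
qed

lemma nc_E: "nc V E = 1"
proof -
  have "cl V E v = V" if "v \<in> V" for v using connected[OF that] unfolding cl_def E_def by blast
  then have "cl V E ` V = {V}" using r0(1) by auto
  then show ?thesis by (simp add: nc_cl)
qed

text \<open>The total turning is counted twice: 4 for each vertex minus 4 for each edge on one side,
  4 for the outer orbit minus 4 for each other orbit on the other side. This determines the number
  of orbits.\<close>

lemma euler_E: "euler E = 0"
proof -
  let ?O = "orb (nxt E) ` D"
  have fO: "finite ?O" using finD by simp
  have rO: "orb (nxt E) r \<in> ?O" using r_in by simp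
  have "4 * int (card V) - 4 * int (card E) = (\<Sum>X\<in>?O. sum (turn E) X)"
    using sum_turn[of E] sum_orbits[of E "turn E"] by simp
  also have "\<dots> = sum (turn E) (orb (nxt E) r) + (\<Sum>X\<in>?O - {orb (nxt E) r}. sum (turn E) X)"
    using fO rO by (rule sum.remove)
  also have "(\<Sum>X\<in>?O - {orb (nxt E) r}. sum (turn E) X) = (\<Sum>X\<in>?O - {orb (nxt E) r}. -4)"
  proof (rule sum.cong)
    fix X assume "X \<in> ?O - {orb (nxt E) r}"
    then obtain c where c: "c \<in> D" "X = orb (nxt E) c" "orb (nxt E) c \<noteq> orb (nxt E) r" by blast
    then have "c \<notin> orb (nxt E) r" using orb_eq[OF periodic_nxt[OF order_refl r_in], of c] by auto
    then show "sum (turn E) X = -4" using turn_orb_E_other c by simp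
  qed simp
  also have "\<dots> = -4 * (int (card ?O) - 1)"
  proof -
    have "card ?O \<ge> 1" using fO rO by (metis One_nat_def Suc_leI card_gt_0_iff empty_iff)
    then show ?thesis using fO rO by (simp add: of_nat_diff)
  qed
  finally show ?thesis using turn_orb_E nc_E by (simp add: euler_def)
qed

lemma euler_zero: "\<omega> \<subseteq> E \<Longrightarrow> euler \<omega> = 0"
  using euler_E_le[of \<omega>] euler_le_empty[of \<omega>] euler_empty euler_E by linarith

text \<open>The planarity input. If the sides were on different orbits, opening the edge would
  strictly lower \<open>euler\<close>, which is 0 both before and after.\<close>

lemma connected_same_orbit:
  assumes "insert e \<omega> \<subseteq> E" "e \<notin> \<omega>" "e = {fst c, fst c + snd c}" "c \<in> D"
    and "connects \<omega> (fst c) (fst c + snd c)"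
  shows "opp c \<in> orb (nxt \<omega>) c"
proof (rule ccontr)
  assume "opp c \<notin> orb (nxt \<omega>) c"
  then have "euler (insert e \<omega>) < euler \<omega>" by (rule euler_insert(2)[OF assms])
  moreover have "\<omega> \<subseteq> E" using assms(1) by simp
  ultimately show False using euler_zero assms(1) by simp
qed

end

section \<open>Winding of the exploration path\<close>

context sc_domain begin

lemma sum_turn_other:
  "c \<notin> X \<Longrightarrow> opp c \<notin> X \<Longrightarrow> sum (turn (insert {fst c, fst c + snd c} \<omega>)) X = sum (turn \<omega>) X"
  by (intro sum.cong refl turn_insert_other) auto

text \<open>Starting from the full configuration, each removed edge of a connected configuration merges
  two orbits, at most one of which is the outer one.\<close>

lemma turn_orb_connected:
  assumes "\<omega> \<subseteq> E" "\<And>v. v \<in> V \<Longrightarrow> connects \<omega> origin v"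
  shows "ext \<subseteq> orb (nxt \<omega>) r" "sum (turn \<omega>) (orb (nxt \<omega>) r) = 4"
proof -
  have "(\<forall>v\<in>V. connects \<omega> origin v) \<longrightarrow> ext \<subseteq> orb (nxt \<omega>) r \<and> sum (turn \<omega>) (orb (nxt \<omega>) r) = 4 \<and>
    (\<forall>c\<in>D. c \<notin> orb (nxt \<omega>) r \<longrightarrow> sum (turn \<omega>) (orb (nxt \<omega>) c) = -4)"
    using assms(1)
  proof (induction \<omega> rule: remove_edges_induct)
    case full
    show ?case using ext_orb_E turn_orb_E turn_orb_E_other by blast
  next
    case (remove e \<omega>)
    show ?case
    proof (intro impI)
      assume con: "\<forall>v\<in>V. connects \<omega> origin v"
      have "e \<in> E" using remove by simp
      then obtain a where a: "e = {fst a, fst a + snd a}" "a \<in> D" "opp a \<in> D" "a \<noteq> opp a"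
        "fst a \<in> V" "fst a + snd a \<in> V" by (rule dart_of_edge)
      define b f g where "b = opp a" and "f = nxt \<omega>" and "g = nxt (insert e \<omega>)"
      have sub: "\<omega> \<subseteq> E" "insert e \<omega> \<subseteq> E" using remove by auto
      have no: "\<not> is_open \<omega> a" using remove(2) a by (simp add: is_open_def)
      have sw: "swapped f g a b" unfolding f_def g_def b_def a(1) by (rule swapped_nxt[OF no])
      have "connects \<omega> (fst a) (fst a + snd a)" using con a connects_sym connects_trans by blast
      then have bf: "b \<in> orb f a" unfolding b_def f_def
        by (rule connected_same_orbit[OF remove(1,2) a(1,2)])
      have pf: "periodic f c" "periodic g c" if "c \<in> D" for c
        using periodic_nxt that sub by (auto simp: f_def g_def)
      have bD: "b \<in> D" using a by (simp add: b_def)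
      have U: "orb f a = orb g a \<union> orb g b" using orb_union[OF _ sw bf] pf(1) a bD by blast
      have bg: "b \<notin> orb g a"
        using split_or_merge[OF _ pf(1)[OF a(2)] bf _ sw] a(4) inj_nxt by (simp add: b_def f_def)
      have dis: "orb g a \<inter> orb g b = {}"
        unfolding g_def by (rule orb_disjoint[OF sub(2) a(2) bD bg[unfolded g_def]])
      define tf tg where "tf = turn \<omega>" and "tg = turn (insert e \<omega>)"
      have "sum tf (orb f a) = sum tg (orb f a) + 4" unfolding tf_def tg_def a(1)
        using a(4) bf no finite_orb[OF pf(1)[OF a(2)]] by (intro sum_turn_insert) (auto simp: b_def)
      also have "sum tg (orb f a) = sum tg (orb g a) + sum tg (orb g b)"
        unfolding U using dis finite_orb[OF pf(2)] a bD by (intro sum.union_disjoint) auto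
      \<comment> \<open>Closing an edge adds 4 to the sum of the two merged orbits: outer orbit and
        face give 4 - 4 + 4 = 4, two faces give -4 - 4 + 4 = -4, so the dichotomy persists.\<close>
      finally have T: "sum tf (orb f a) = sum tg (orb g a) + sum tg (orb g b) + 4" by simp
      have other: "orb f c = orb g c" "sum tf (orb f c) = sum tg (orb g c)"
        if "c \<in> D" "c \<notin> orb f a" for c
      proof -
        have d: "orb f a \<inter> orb f c = {}"
          unfolding f_def by (rule orb_disjoint[OF sub(1) a(2) that(1) that(2)[unfolded f_def]])
        then have n: "a \<notin> orb f c" "b \<notin> orb f c" using bf by auto
        show "orb f c = orb g c" using orb_swapped_other[OF sw n] by simp
        then show "sum tf (orb f c) = sum tg (orb g c)"
          using sum_turn_other[of a "orb f c" \<omega>] n by (simp add: tf_def tg_def a(1) b_def)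
      qed
      have "\<forall>v\<in>V. connects (insert e \<omega>) origin v" using con connects_mono[OF _ subset_insertI] by blast
      then have IH: "ext \<subseteq> orb g r" "sum tg (orb g r) = 4" "\<And>c. c \<in> D \<Longrightarrow> c \<notin> orb g r \<Longrightarrow> sum tg (orb g c) = -4"
        using remove(3) by (auto simp: g_def tg_def)
      have geq: "orb g c = orb g c'" if "c' \<in> orb g c" "c \<in> D" for c c'
        using orb_eq[OF pf(2)] that by metis
      have feq: "orb f c = orb f c'" if "c' \<in> orb f c" "c \<in> D" for c c'
        using orb_eq[OF pf(1)] that by metis
      have "ext \<subseteq> orb f r \<and> sum tf (orb f r) = 4 \<and> (\<forall>c\<in>D. c \<notin> orb f r \<longrightarrow> sum tf (orb f c) = -4)"
      proof (cases "r \<in> orb f a")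
        case True
        then have fr: "orb f r = orb f a" using feq a by metis
        have "r \<in> orb g a \<and> r \<notin> orb g b \<or> r \<in> orb g b \<and> r \<notin> orb g a" using True U dis by auto
        then have "sum tg (orb g a) + sum tg (orb g b) = 0 \<and> orb g r \<subseteq> orb f a"
        proof
          assume h: "r \<in> orb g a \<and> r \<notin> orb g b"
          then have "orb g r = orb g a" using geq a by metis
          moreover have "b \<notin> orb g r" using bg calculation by simp
          ultimately show ?thesis using IH(2) IH(3)[OF bD] U by auto
        next
          assume h: "r \<in> orb g b \<and> r \<notin> orb g a"
          then have "orb g r = orb g b" using geq bD by metis
          moreover have "a \<notin> orb g r" using dis calculation by auto
          ultimately show ?thesis using IH(2) IH(3)[OF a(2)] U by auto
        qed
        then have 1: "sum tf (orb f r) = 4" "orb g r \<subseteq> orb f r" using T fr by auto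
        have "sum tf (orb f c) = -4" if c: "c \<in> D" "c \<notin> orb f r" for c
          using other[of c] IH(3)[OF c(1)] 1(2) c fr by auto
        then show ?thesis using 1 IH(1) by auto
      next
        case False
        have fr: "orb f r = orb g r" "sum tf (orb f r) = sum tg (orb g r)" using other[OF r_in False] .
        have "orb f r \<inter> orb f a = {}"
          using orb_disjoint[OF sub(1) a(2) r_in] False by (auto simp: f_def)
        then have "a \<notin> orb g r" "b \<notin> orb g r" using bf fr by auto
        then have fa: "sum tf (orb f a) = -4" using T IH(3) a bD by simp
        have "sum tf (orb f c) = -4" if c: "c \<in> D" "c \<notin> orb f r" for c
        proof (cases "c \<in> orb f a")
          case True then show ?thesis using fa feq a by metis
        next
          case False then show ?thesis using other[OF c(1) False] IH(3)[OF c(1)] c fr by simp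
        qed
        then show ?thesis using IH fr by auto
      qed
      then show "ext \<subseteq> orb (nxt \<omega>) r \<and> sum (turn \<omega>) (orb (nxt \<omega>) r) = 4 \<and>
        (\<forall>c\<in>D. c \<notin> orb (nxt \<omega>) r \<longrightarrow> sum (turn \<omega>) (orb (nxt \<omega>) c) = -4)"
        by (simp add: f_def tf_def)
    qed
  qed
  then show "ext \<subseteq> orb (nxt \<omega>) r" "sum (turn \<omega>) (orb (nxt \<omega>) r) = 4" using assms by auto
qed

text \<open>Vertices outside the cluster of the origin are attached as leaves, which does not change
  the turning of the orbit of r.\<close>

lemma turn_orb_cluster:
  assumes "\<omega> \<subseteq> E" "\<And>e x. e \<in> \<omega> \<Longrightarrow> x \<in> e \<Longrightarrow> connects \<omega> origin x"
  shows "sum (turn \<omega>) (orb (nxt \<omega>) r) = 4 \<and> (\<forall>c\<in>ext. connects \<omega> origin (fst c) \<longrightarrow> c \<in> orb (nxt \<omega>) r)"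
  using assms
proof (induction "card {v \<in> V. \<not> connects \<omega> origin v}" arbitrary: \<omega>)
  case 0
  then have "{v \<in> V. \<not> connects \<omega> origin v} = {}" using fin by simp
  then have "\<And>v. v \<in> V \<Longrightarrow> connects \<omega> origin v" by blast
  then show ?case using turn_orb_connected[OF 0(2)] by blast
next
  case (Suc k)
  then have "{v \<in> V. \<not> connects \<omega> origin v} \<noteq> {}" by (metis card.empty nat.distinct(1))
  then obtain y where y: "y \<in> V" "\<not> connects \<omega> origin y" by blast
  \<comment> \<open>The domain is connected, so some edge leaves the cluster of the origin. All open
    edges lie in that cluster, hence the far endpoint \<open>w\<close> is isolated.\<close>
  have "\<exists>u w. {u, w} \<in> E \<and> connects \<omega> origin u \<and> \<not> connects \<omega> origin w"
  proof (rule ccontr)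
    assume n: "\<not> ?thesis"
    have "connects E origin y" using connected r0(1) y unfolding E_def origin_def by blast
    then have "connects \<omega> origin y" by (rule connects_induct) (use n in auto)
    then show False using y by simp
  qed
  then obtain u w where uw: "{u, w} \<in> E" "connects \<omega> origin u" "\<not> connects \<omega> origin w" by blast
  obtain a0 where a0: "{u, w} = {fst a0, fst a0 + snd a0}" "a0 \<in> D" "opp a0 \<in> D" "a0 \<noteq> opp a0"
    using uw(1) by (rule dart_of_edge)
  define a where "a = (if fst a0 = u then a0 else opp a0)"
  have a: "a \<in> D" "opp a \<in> D" "a \<noteq> opp a" using a0 by (auto simp: a_def)
  have uwn: "u \<noteq> w" using uw by auto
  have fa: "fst a = u" "fst a + snd a = w" using a0(1) uwn by (auto simp: a_def opp_def doubleton_eq_iff)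
  define e where "e = {fst a, fst a + snd a}"
  have e: "e \<in> E" using uw fa by (simp add: e_def)
  define b f g where "b = opp a" and "f = nxt \<omega>" and "g = nxt (insert e \<omega>)"
  have fb: "fst b = w" using fa by (simp add: b_def opp_def)
  have notw: "w \<notin> e'" if "e' \<in> \<omega>" for e' using Suc.prems(2)[OF that] uw(3) by blast
  have ne: "e \<notin> \<omega>" using notw[of e] fa by (auto simp: e_def)
  have sub: "\<omega> \<subseteq> E" "insert e \<omega> \<subseteq> E" using Suc.prems e by auto
  have no: "\<not> is_open \<omega> a" using ne by (simp add: is_open_def e_def)
  have sw: "swapped f g a b" unfolding f_def g_def b_def e_def by (rule swapped_nxt[OF no])
  have pf: "periodic f c" "periodic g c" if "c \<in> D" for c
    using periodic_nxt that sub by (auto simp: f_def g_def)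
  have bD: "b \<in> D" using a by (simp add: b_def)
  have isol: "orb f b = {w} \<times> dirs" "sum (turn \<omega>) (orb f b) = 4"
  proof -
    have o: "\<not> is_open \<omega> (w, d)" for d using notw by (auto simp: is_open_def)
    have "b = (w, snd b)" "snd b \<in> dirs" using fb bD by (auto simp: D_def prod_eq_iff)
    then show "orb f b = {w} \<times> dirs" "sum (turn \<omega>) (orb f b) = 4"
      using orb_isolated[of \<omega> w "snd b"] o by (simp_all add: f_def)
  qed
  have aw: "a \<notin> orb f b" using isol(1) fa uwn by (auto simp: mem_Times_iff)
  have bg: "b \<in> orb g a" using merge_reaches[OF _ pf(1)[OF bD] aw sw] inj_nxt by (simp add: f_def)
  have U: "orb g a = orb f a \<union> orb f b"
    using orb_union[OF _ swapped_sym[OF sw] bg] pf(2) a bD by blast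
  have bfa: "b \<notin> orb f a" using aw orb_sym[OF pf(1)[OF a(1)], of b] by blast
  have dis: "orb f a \<inter> orb f b = {}"
    unfolding f_def by (rule orb_disjoint[OF sub(1) a(1) bD bfa[unfolded f_def]])
  have "sum (turn \<omega>) (orb g a) = sum (turn (insert e \<omega>)) (orb g a) + 4"
    unfolding e_def using a(3) bg no finite_orb[OF pf(2)[OF a(1)]]
    by (intro sum_turn_insert) (auto simp: b_def)
  moreover have "sum (turn \<omega>) (orb g a) = sum (turn \<omega>) (orb f a) + sum (turn \<omega>) (orb f b)"
    unfolding U using dis finite_orb[OF pf(1)] a bD by (intro sum.union_disjoint) auto
  \<comment> \<open>The orbit around the isolated vertex brings turning 4, and opening the edge to
    it takes 4 away.\<close>
  ultimately have T: "sum (turn (insert e \<omega>)) (orb g a) = sum (turn \<omega>) (orb f a)" using isol(2) by simp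
  have ins: "connects (insert e \<omega>) origin x \<longleftrightarrow> connects \<omega> origin x \<or> x = w" for x
  proof -
    have "connects \<omega> w x \<longleftrightarrow> x = w"
    proof
      assume "connects \<omega> w x"
      then show "x = w" by (rule connects_induct) (use notw in auto)
    qed auto
    moreover have "e = {u, w}" using fa by (simp add: e_def)
    ultimately show ?thesis using uw connects_insert[of u w \<omega> origin x] by blast
  qed
  have wV: "w \<in> V" using bD fb by (auto simp: D_def)
  have "{v \<in> V. \<not> connects (insert e \<omega>) origin v} = {v \<in> V. \<not> connects \<omega> origin v} - {w}"
    using ins by blast
  then have "card {v \<in> V. \<not> connects (insert e \<omega>) origin v} = card {v \<in> V. \<not> connects \<omega> origin v} - 1"
    using wV uw(3) fin by simp
  then have k: "k = card {v \<in> V. \<not> connects (insert e \<omega>) origin v}" using Suc(2) by simp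
  have "connects (insert e \<omega>) origin x" if "e' \<in> insert e \<omega>" "x \<in> e'" for e' x
  proof (cases "e' \<in> \<omega>")
    case True then show ?thesis using ins Suc.prems(2)[OF True that(2)] by blast
  next
    case False
    then have "x = u \<or> x = w" using that fa by (auto simp: e_def)
    then show ?thesis using ins uw(2) by blast
  qed
  then have IH: "sum (turn (insert e \<omega>)) (orb g r) = 4"
    "\<And>c. c \<in> ext \<Longrightarrow> connects (insert e \<omega>) origin (fst c) \<Longrightarrow> c \<in> orb g r"
    using Suc(1)[OF k sub(2)] by (auto simp: g_def)
  have ext': "c \<in> orb g r \<and> c \<notin> orb f b" if "c \<in> ext" "connects \<omega> origin (fst c)" for c
    using IH(2)[of c] ins that uw(3) isol(1) by auto
  show ?case
  proof (cases "r \<in> orb g a")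
    case True
    have "r \<notin> orb f b" using isol(1) fst_r uw(3) by (auto simp: mem_Times_iff)
    then have "r \<in> orb f a" using True U by simp
    then have "orb f r = orb f a" "orb g r = orb g a"
      using orb_eq[OF pf(1)[OF a(1)], of r] orb_eq[OF pf(2)[OF a(1)] True] by auto
    then have "sum (turn \<omega>) (orb f r) = 4"
      "\<And>c. c \<in> ext \<Longrightarrow> connects \<omega> origin (fst c) \<Longrightarrow> c \<in> orb f r"
      using IH(1) T ext' U by (simp, blast)
    then show ?thesis by (simp add: f_def)
  next
    case False
    have d: "orb g a \<inter> orb g r = {}"
      unfolding g_def by (rule orb_disjoint[OF sub(2) a(1) r_in False[unfolded g_def]])
    then have n: "a \<notin> orb g r" "b \<notin> orb g r" using bg by auto
    have fr: "orb f r = orb g r" by (rule orb_swapped_other[OF swapped_sym[OF sw] n])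
    have "sum (turn (insert e \<omega>)) (orb g r) = sum (turn \<omega>) (orb g r)"
      unfolding e_def using n by (intro sum_turn_other) (auto simp: b_def)
    then have "sum (turn \<omega>) (orb f r) = 4" using IH(1) fr by simp
    moreover have "c \<in> orb f r" if "c \<in> ext" "connects \<omega> origin (fst c)" for c
      using ext'[OF that] fr by simp
    ultimately show ?thesis by (simp add: f_def)
  qed
qed

text \<open>The orbit of \<open>r\<close> sees only edges that touch the cluster of the origin.
  Dropping all others changes neither the orbit nor that cluster and brings the configuration into
  the form of \<open>turn_orb_cluster\<close>.\<close>

lemma turn_orb_r:
  assumes w: "\<omega> \<subseteq> E"
  shows "sum (turn \<omega>) (orb (nxt \<omega>) r) = 4"
    and "c \<in> ext \<Longrightarrow> c \<in> orb (nxt \<omega>) r \<longleftrightarrow> connects \<omega> origin (fst c)"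
proof -
  define \<omega>' where "\<omega>' = {e \<in> \<omega>. \<exists>x\<in>e. connects \<omega> origin x}"
  have sub: "\<omega>' \<subseteq> \<omega>" "\<omega>' \<subseteq> E" using w by (auto simp: \<omega>'_def)
  have con: "connects \<omega>' origin x \<longleftrightarrow> connects \<omega> origin x" for x
  proof
    assume "connects \<omega> origin x"
    then show "connects \<omega>' origin x"
    proof (rule connects_induct)
      fix y z assume h: "connects \<omega> origin y" "{y, z} \<in> \<omega>" "connects \<omega>' origin y"
      then have "{y, z} \<in> \<omega>'" by (auto simp: \<omega>'_def)
      then show "connects \<omega>' origin z" using h connects_edge connects_trans by blast
    qed simp
  qed (use sub connects_mono in blast)
  have all: "connects \<omega>' origin x" if ex: "e \<in> \<omega>'" "x \<in> e" for e x
  proof -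
    obtain y where y: "y \<in> e" "connects \<omega> origin y" "e \<in> \<omega>" using ex unfolding \<omega>'_def by blast
    have "e \<in> edges_in V" using y(3) w by (auto simp: E_def)
    then obtain u v where "e = {u, v}" by (rule edges_inE)
    then have "x = y \<or> e = {y, x}" using y(1) ex(2) by auto
    then have "connects \<omega> y x" using y(3) connects_edge[of y x \<omega>] by auto
    then show ?thesis using con y connects_trans by blast
  qed
  have R: "sum (turn \<omega>') (orb (nxt \<omega>') r) = 4"
    "\<And>c. c \<in> ext \<Longrightarrow> connects \<omega>' origin (fst c) \<Longrightarrow> c \<in> orb (nxt \<omega>') r"
    using turn_orb_cluster[OF sub(2) all] by auto
  have op: "is_open \<omega> c \<longleftrightarrow> is_open \<omega>' c" if "c \<in> orb (nxt \<omega>') r" for c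
    using orb_connected[OF that] con fst_r unfolding is_open_def \<omega>'_def by auto
  have o: "orb (nxt \<omega>) r = orb (nxt \<omega>') r" by (rule orb_congr) (simp add: nxt_def op)
  have "sum (turn \<omega>) (orb (nxt \<omega>) r) = sum (turn \<omega>') (orb (nxt \<omega>') r)"
    unfolding o using op by (intro sum.cong) (auto simp: turn_def)
  then show "sum (turn \<omega>) (orb (nxt \<omega>) r) = 4" using R by simp
  show "c \<in> ext \<Longrightarrow> c \<in> orb (nxt \<omega>) r \<longleftrightarrow> connects \<omega> origin (fst c)"
    using R(2)[of c] o con[of "fst c"] orb_connected[of c \<omega> r] fst_r by auto
qed

abbreviation "winding \<omega> c \<equiv> lift (nxt \<omega>) (turn \<omega>) r c"

lemma pair_cases:
  assumes "insert e \<omega> \<subseteq> E" "e \<notin> \<omega>" "e = {fst a, fst a + snd a}" "a \<in> D" "opp a \<in> D" "a \<noteq> opp a"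
  obtains "a \<notin> orb (nxt \<omega>) r" "opp a \<notin> orb (nxt \<omega>) r"
    | i j where "surgery (nxt \<omega>) (nxt (insert e \<omega>)) a (opp a) r i j"
    | i j where "surgery (nxt \<omega>) (nxt (insert e \<omega>)) (opp a) a r i j"
    | i j where "surgery (nxt (insert e \<omega>)) (nxt \<omega>) a (opp a) r i j"
    | i j where "surgery (nxt (insert e \<omega>)) (nxt \<omega>) (opp a) a r i j"
proof -
  have no: "\<not> is_open \<omega> a" using assms(2,3) by (simp add: is_open_def)
  have sw: "swapped (nxt \<omega>) (nxt (insert e \<omega>)) a (opp a)" unfolding assms(3) by (rule swapped_nxt[OF no])
  have pf: "periodic (nxt \<omega>) c" if "c \<in> {a, opp a, r}" for c
    using that assms(1,4,5) r_in by (intro periodic_nxt) auto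
  have pg: "periodic (nxt (insert e \<omega>)) r" by (rule periodic_nxt[OF assms(1) r_in])
  show thesis
    by (rule surgery_cases[OF inj_nxt inj_nxt pf pg sw assms(6)]) (use that in blast)+
qed

text \<open>Opening an edge keeps \<open>c\<close> connected to the origin, so \<open>c\<close> lies
  on the orbit of \<open>r\<close> both before and after, in particular on the shorter of the two.
  Both orbits have total turning 4, so \<open>lift_common\<close> applies in either
  direction.\<close>

lemma winding_ext_step:
  assumes "insert e \<omega> \<subseteq> E" "e \<notin> \<omega>" "c \<in> ext" "c \<in> orb (nxt \<omega>) r"
  shows "winding \<omega> c = winding (insert e \<omega>) c" "c \<in> orb (nxt (insert e \<omega>)) r"
proof -
  have sub: "\<omega> \<subseteq> E" "e \<in> E" using assms by auto
  have con: "connects \<omega> origin (fst c)" using turn_orb_r(2)[OF sub(1)] assms by blast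
  then have "connects (insert e \<omega>) origin (fst c)" by (rule connects_mono) auto
  then show c': "c \<in> orb (nxt (insert e \<omega>)) r" using turn_orb_r(2)[OF assms(1,3)] by blast
  obtain a where a: "e = {fst a, fst a + snd a}" "a \<in> D" "opp a \<in> D" "a \<noteq> opp a"
    using sub(2) by (rule dart_of_edge)
  have T: "sum (turn \<omega>) (orb (nxt \<omega>) r) = sum (turn (insert e \<omega>)) (orb (nxt (insert e \<omega>)) r)"
    using turn_orb_r(1) sub(1) assms(1) by simp
  have t: "turn (insert e \<omega>) x = turn \<omega> x" "turn \<omega> x = turn (insert e \<omega>) x"
    if "x \<noteq> a" "x \<noteq> opp a" for x
    unfolding a(1) using turn_insert_other that by metis+
  have no: "\<not> is_open \<omega> a" using assms(2) a by (simp add: is_open_def)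
  show "winding \<omega> c = winding (insert e \<omega>) c"
  proof (rule pair_cases[OF assms(1,2) a])
    assume n: "a \<notin> orb (nxt \<omega>) r" "opp a \<notin> orb (nxt \<omega>) r"
    have sw: "swapped (nxt \<omega>) (nxt (insert e \<omega>)) a (opp a)" unfolding a(1) by (rule swapped_nxt[OF no])
    have "winding (insert e \<omega>) c = winding \<omega> c"
    proof (rule lift_congr)
      fix x assume "x \<in> orb (nxt \<omega>) r"
      then have x: "x \<noteq> a" "x \<noteq> opp a" using n by auto
      show "nxt (insert e \<omega>) x = nxt \<omega> x" using sw x unfolding swapped_def by blast
      show "turn \<omega> x = turn (insert e \<omega>) x" using t x by simp
    qed
    then show ?thesis by simp
  next
    fix i j assume "surgery (nxt \<omega>) (nxt (insert e \<omega>)) a (opp a) r i j"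
    from surgery.lift_common[OF this t(1) T c'] show ?thesis by simp
  next
    fix i j assume "surgery (nxt \<omega>) (nxt (insert e \<omega>)) (opp a) a r i j"
    from surgery.lift_common[OF this t(1) T c'] show ?thesis by simp
  next
    fix i j assume "surgery (nxt (insert e \<omega>)) (nxt \<omega>) a (opp a) r i j"
    from surgery.lift_common[OF this t(2) T[symmetric] assms(4)] show ?thesis by simp
  next
    fix i j assume "surgery (nxt (insert e \<omega>)) (nxt \<omega>) (opp a) a r i j"
    from surgery.lift_common[OF this t(2) T[symmetric] assms(4)] show ?thesis by simp
  qed
qed

lemma winding_ext:
  assumes "\<omega> \<subseteq> E" "c \<in> ext" "c \<in> orb (nxt \<omega>) r"
  shows "winding \<omega> c = winding E c"
proof -
  have "c \<in> orb (nxt \<omega>) r \<longrightarrow> winding \<omega> c = winding E c"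
    using assms(1)
  proof (induction \<omega> rule: remove_edges_induct)
    case (remove e \<omega>)
    then show ?case using winding_ext_step[OF remove(1,2) assms(2)] by simp
  qed simp
  then show ?thesis using assms by simp
qed

end

section \<open>The parafermionic observable\<close>

lemma wt_insert_connected:
  assumes "finite \<omega>" "{u, v} \<notin> \<omega>" "connects \<omega> u v"
  shows "wt V q (insert {u, v} \<omega>) = sqrt q * wt V q \<omega>"
  using assms by (simp add: wt_def nc_insert_connected)

lemma wt_insert_disconnected:
  assumes "finite V" "u \<in> V" "v \<in> V" "finite \<omega>" "{u, v} \<notin> \<omega>" "\<not> connects \<omega> u v" "q \<ge> 0"
  shows "wt V q \<omega> = sqrt q * wt V q (insert {u, v} \<omega>)"
  using assms nc_insert_disconnected[OF assms(1-3,6)] by (simp add: wt_def)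

context sc_domain begin

text \<open>\<open>\<omega>1\<close> is the configuration in which the orbit of \<open>r\<close>
  passes both sides of the edge. The side \<open>y\<close> visited second is cut off in
  \<open>\<omega>2\<close>, and the last equation determines its winding from that of
  \<open>x\<close>.\<close>

lemma surgery_windings:
  assumes s: "surgery (nxt \<omega>1) (nxt \<omega>2) x y r i j" and w: "\<omega>1 \<subseteq> E" "\<omega>2 \<subseteq> E"
    and t: "\<And>z. z \<noteq> x \<Longrightarrow> z \<noteq> y \<Longrightarrow> turn \<omega>2 z = turn \<omega>1 z"
  shows "x \<in> orb (nxt \<omega>1) r" "y \<in> orb (nxt \<omega>1) r" "x \<in> orb (nxt \<omega>2) r" "y \<notin> orb (nxt \<omega>2) r"
    "winding \<omega>2 x = winding \<omega>1 x"
    "winding \<omega>1 y + turn \<omega>1 y = winding \<omega>2 x + turn \<omega>2 x"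
proof -
  interpret surgery "nxt \<omega>1" "nxt \<omega>2" x y r i j by (rule s)
  have T: "sum (turn \<omega>1) (orb (nxt \<omega>1) r) = sum (turn \<omega>2) (orb (nxt \<omega>2) r)"
    using turn_orb_r(1) w by simp
  show "x \<in> orb (nxt \<omega>1) r" "y \<in> orb (nxt \<omega>1) r" using ai bj by auto
  show "x \<in> orb (nxt \<omega>2) r" "y \<notin> orb (nxt \<omega>2) r" by (rule a_in b_notin)+
  show "winding \<omega>2 x = winding \<omega>1 x" using t by (rule lift_a)
  show "winding \<omega>1 y + turn \<omega>1 y = winding \<omega>2 x + turn \<omega>2 x" by (rule lift_ab[OF t T])
qed

text \<open>With c the difference of \<open>S\<close>, a closed dart of winding w contributes c(w)
  and an open one -c(w - 1). Writing both as increments of one primitive makes the sum along the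
  orbit telescope in every configuration.\<close>

definition incr :: "(int \<Rightarrow> real) \<Rightarrow> vert set set \<Rightarrow> dart \<Rightarrow> real" where
  "incr S \<omega> x = (if x \<in> orb (nxt \<omega>) r then S (winding \<omega> x + turn \<omega> x) - S (winding \<omega> x) else 0)"

lemma sum_incr: assumes w: "\<omega> \<subseteq> E" shows "sum (incr S \<omega>) D = S 4 - S 0"
proof -
  let ?f = "nxt \<omega>"
  define L where "L l = (\<Sum>k<l. turn \<omega> ((?f ^^ k) r))" for l
  have p: "periodic ?f r" by (rule periodic_nxt[OF w r_in])
  have "sum (incr S \<omega>) D = sum (incr S \<omega>) (orb ?f r)"
    by (rule sum.mono_neutral_right[OF finD orb_D[OF w r_in]]) (auto simp: incr_def)
  also have "\<dots> = (\<Sum>l<per ?f r. incr S \<omega> ((?f ^^ l) r))" by (rule sum_orb[OF inj_nxt p])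
  also have "\<dots> = (\<Sum>l<per ?f r. S (L (Suc l)) - S (L l))"
  proof (rule sum.cong)
    fix l assume "l \<in> {..<per ?f r}"
    then have "winding \<omega> ((?f ^^ l) r) = L l" unfolding L_def by (intro lift_funpow inj_nxt) simp
    then show "incr S \<omega> ((?f ^^ l) r) = S (L (Suc l)) - S (L l)" by (auto simp: incr_def L_def)
  qed simp
  also have "\<dots> = S (L (per ?f r)) - S (L 0)" by (rule sum_lessThan_telescope)
  also have "L (per ?f r) = 4" unfolding L_def using sum_orb[OF inj_nxt p, of "turn \<omega>"] turn_orb_r(1)[OF w] by simp
  finally show ?thesis by (simp add: L_def)
qed

text \<open>The discrete Cauchy--Riemann relation of the parafermionic observable.\<close>

lemma incr_pair:
  fixes S c :: "int \<Rightarrow> real"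
  assumes q: "q \<ge> 0" and rec: "\<And>w. c (w + 1) + c (w - 1) = sqrt q * c w"
    and S: "\<And>w. S (w + 1) - S w = c w"
    and sub: "insert e \<omega> \<subseteq> E" "e \<notin> \<omega>"
    and a: "e = {fst a, fst a + snd a}" "a \<in> D" "opp a \<in> D" "a \<noteq> opp a" "fst a \<in> V" "fst a + snd a \<in> V"
  shows "wt V q \<omega> * (incr S \<omega> a + incr S \<omega> (opp a))
    + wt V q (insert e \<omega>) * (incr S (insert e \<omega>) a + incr S (insert e \<omega>) (opp a)) = 0"
proof -
  let ?\<omega>' = "insert e \<omega>" and ?b = "opp a"
  have w: "\<omega> \<subseteq> E" "?\<omega>' \<subseteq> E" using sub by auto
  have no: "\<not> is_open \<omega> a" using sub(2) a by (simp add: is_open_def)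
  have t: "turn ?\<omega>' x = turn \<omega> x" if "x \<noteq> a" "x \<noteq> ?b" for x
    unfolding a(1) by (rule turn_insert_other[OF that])
  have t1: "turn \<omega> x = 1" "turn ?\<omega>' x = -1" if "x = a \<or> x = ?b" for x
    using that no turn_insert_same[of a \<omega>] unfolding a(1) by (auto simp: turn_def[of \<omega>])
  have sw: "swapped (nxt \<omega>) (nxt ?\<omega>') a ?b" unfolding a(1) by (rule swapped_nxt[OF no])
  have pf: "periodic (nxt \<omega>) a" "periodic (nxt \<omega>) r" using periodic_nxt w a r_in by auto
  have S': "S (w - 1) - S w = - c (w - 1)" for w using S[of "w - 1"] by simp
  have fw: "finite \<omega>" by (rule finite_sub[OF w(1)])
  have ne: "{fst a, fst a + snd a} \<notin> \<omega>" using sub(2) a by simp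
  have long_closed: "wt V q \<omega> * (incr S \<omega> x + incr S \<omega> y) + wt V q ?\<omega>' * (incr S ?\<omega>' x + incr S ?\<omega>' y) = 0"
    if s: "surgery (nxt \<omega>) (nxt ?\<omega>') x y r i j" and xy: "x = a \<and> y = ?b \<or> x = ?b \<and> y = a" for x y i j
  proof -
    have tt: "\<And>z. z \<noteq> x \<Longrightarrow> z \<noteq> y \<Longrightarrow> turn ?\<omega>' z = turn \<omega> z" using t xy by blast
    note W = surgery_windings[OF s w tt]
    have T: "turn \<omega> x = 1" "turn \<omega> y = 1" "turn ?\<omega>' x = -1" using t1 xy by blast+
    define u where "u = winding \<omega> x"
    have wy: "winding \<omega> y = u - 2" using W(5,6) T by (simp add: u_def)
    have "?b \<in> orb (nxt \<omega>) a" using W(1,2) xy orb_eq[OF pf(2)] by metis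
    then have "connects \<omega> (fst a) (fst a + snd a)" using orb_connected[of ?b \<omega> a] by (simp add: opp_def)
    then have wt: "wt V q ?\<omega>' = sqrt q * wt V q \<omega>"
      unfolding a(1) by (rule wt_insert_connected[OF fw ne])
    have "incr S \<omega> x = c u" using W(1) T S[of u] by (simp add: incr_def u_def)
    moreover have "incr S \<omega> y = c (u - 2)" using W(2) T S[of "u - 2"] wy by (simp add: incr_def)
    moreover have "incr S ?\<omega>' x = - c (u - 1)" using W(3,5) T S'[of u] by (simp add: incr_def u_def)
    moreover have "incr S ?\<omega>' y = 0" using W(4) by (simp add: incr_def)
    \<comment> \<open>The recurrence at \<open>u - 1\<close>: the outer values come from the two
      visits with the edge closed, the middle value from the single visit with it open, weighted by
      the ratio sqrt q.\<close>
    moreover have "c u + c (u - 2) = sqrt q * c (u - 1)" using rec[of "u - 1"] by simp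
    ultimately show ?thesis unfolding wt by (simp flip: distrib_left)
  qed
  have long_open: "wt V q \<omega> * (incr S \<omega> x + incr S \<omega> y) + wt V q ?\<omega>' * (incr S ?\<omega>' x + incr S ?\<omega>' y) = 0"
    if s: "surgery (nxt ?\<omega>') (nxt \<omega>) x y r i j" and xy: "x = a \<and> y = ?b \<or> x = ?b \<and> y = a" for x y i j
  proof -
    have tt: "\<And>z. z \<noteq> x \<Longrightarrow> z \<noteq> y \<Longrightarrow> turn \<omega> z = turn ?\<omega>' z" using t xy by metis
    note W = surgery_windings[OF s w(2,1) tt]
    have T: "turn \<omega> x = 1" "turn ?\<omega>' y = -1" "turn ?\<omega>' x = -1" using t1 xy by blast+
    define u where "u = winding \<omega> x"
    have wy: "winding ?\<omega>' y = u + 2" using W(5,6) T by (simp add: u_def)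
    have nb: "?b \<notin> orb (nxt \<omega>) a"
    proof
      assume b: "?b \<in> orb (nxt \<omega>) a"
      then have "orb (nxt \<omega>) ?b = orb (nxt \<omega>) a" by (rule orb_eq[OF pf(1)])
      then have "orb (nxt \<omega>) x = orb (nxt \<omega>) y" using xy by auto
      moreover have "orb (nxt \<omega>) x = orb (nxt \<omega>) r" using W(3) by (rule orb_eq[OF pf(2)])
      ultimately show False using W(4) orb_self[of y "nxt \<omega>"] by simp
    qed
    have nc: "\<not> connects \<omega> (fst a) (fst a + snd a)"
      using connected_same_orbit[OF sub a(1,2)] nb by blast
    have wt: "wt V q \<omega> = sqrt q * wt V q ?\<omega>'"
      unfolding a(1) by (rule wt_insert_disconnected[OF fin a(5,6) fw ne nc q])
    have "incr S \<omega> x = c u" using W(3) T S[of u] by (simp add: incr_def u_def)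
    moreover have "incr S \<omega> y = 0" using W(4) by (simp add: incr_def)
    moreover have "incr S ?\<omega>' x = - c (u - 1)" using W(1,5) T S'[of u] by (simp add: incr_def u_def)
    moreover have "incr S ?\<omega>' y = - c (u + 1)" using W(2) T S'[of "u + 2"] wy
      by (simp add: incr_def add.commute)
    \<comment> \<open>Now the recurrence at \<open>u\<close>: the outer values come from the two
      visits with the edge open, the middle value from the single visit with it closed, and it is
      the closed configuration that carries sqrt q.\<close>
    moreover have "wt V q ?\<omega>' * (sqrt q * c u) = wt V q ?\<omega>' * (c (u + 1) + c (u - 1))"
      unfolding rec ..
    ultimately show ?thesis unfolding wt by (simp add: algebra_simps)
  qed
  show ?thesis
  proof (rule pair_cases[OF sub a(1-4)])
    assume n: "a \<notin> orb (nxt \<omega>) r" "?b \<notin> orb (nxt \<omega>) r"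
    have "orb (nxt ?\<omega>') r = orb (nxt \<omega>) r" by (rule orb_swapped_other[OF sw n])
    then show ?thesis using n by (simp add: incr_def)
  next
    fix i j assume "surgery (nxt \<omega>) (nxt ?\<omega>') a ?b r i j"
    from long_closed[OF this] show ?thesis by simp
  next
    fix i j assume "surgery (nxt \<omega>) (nxt ?\<omega>') ?b a r i j"
    from long_closed[OF this] show ?thesis by (simp add: add.commute)
  next
    fix i j assume "surgery (nxt ?\<omega>') (nxt \<omega>) a ?b r i j"
    from long_open[OF this] show ?thesis by simp
  next
    fix i j assume "surgery (nxt ?\<omega>') (nxt \<omega>) ?b a r i j"
    from long_open[OF this] show ?thesis by (simp add: add.commute)
  qed
qed

text \<open>The increments sum to \<open>S 4 - S 0\<close> in every configuration. After averaging,
  opposite interior darts cancel by \<open>incr_pair\<close>. A boundary dart is always closed and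
  its winding is deterministic, so only its probability of being visited, a connection probability,
  remains.\<close>

lemma boundary_identity:
  fixes S c :: "int \<Rightarrow> real"
  assumes q: "q > 0" and rec: "\<And>w. c (w + 1) + c (w - 1) = sqrt q * c w"
    and S: "\<And>w. S (w + 1) - S w = c w"
  shows "(\<Sum>x\<in>ext. c (winding E x) * pr V q E (\<lambda>\<omega>. connects \<omega> origin (fst x))) = c 0 + c 1 + c 2 + c 3"
proof -
  define Z where "Z = (\<Sum>\<omega>\<in>Pow E. wt V q \<omega>)"
  have Z: "Z > 0" unfolding Z_def using finE q wt_pos by (intro sum_pos) auto
  define G where "G x = (\<Sum>\<omega>\<in>Pow E. wt V q \<omega> * incr S \<omega> x)" for x
  have "(\<Sum>x\<in>D. G x) = (\<Sum>\<omega>\<in>Pow E. \<Sum>x\<in>D. wt V q \<omega> * incr S \<omega> x)"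
    unfolding G_def by (rule sum.swap)
  also have "\<dots> = (\<Sum>\<omega>\<in>Pow E. wt V q \<omega> * (S 4 - S 0))"
    using sum_incr by (intro sum.cong) (auto simp flip: sum_distrib_left)
  also have "\<dots> = (S 4 - S 0) * Z" by (simp add: Z_def sum_distrib_right[symmetric] mult.commute)
  finally have 1: "(\<Sum>x\<in>D. G x) = (S 4 - S 0) * Z" .
  have opp_int: "opp x \<in> D - ext" if "x \<in> D - ext" for x
    using that by (auto simp: ext_def D_def opp_def mem_Times_iff)
  have anti: "G (opp a) = - G a" if "a \<in> D - ext" for a
  proof -
    define e where "e = {fst a, fst a + snd a}"
    have eE: "e \<in> E" using that edge_of_dart by (auto simp: e_def)
    have a: "a \<in> D" "opp a \<in> D" "a \<noteq> opp a" "fst a \<in> V" "fst a + snd a \<in> V"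
      using that opp_int[OF that] opp_neq[of a] dirs_nonzero[of "snd a"]
      by (auto simp: D_def ext_def mem_Times_iff)
    have "G a + G (opp a) = (\<Sum>\<omega>\<in>Pow (insert e (E - {e})). wt V q \<omega> * (incr S \<omega> a + incr S \<omega> (opp a)))"
      using eE unfolding G_def by (simp add: insert_absorb distrib_left sum.distrib)
    also have "\<dots> = (\<Sum>\<omega>\<in>Pow (E - {e}). wt V q \<omega> * (incr S \<omega> a + incr S \<omega> (opp a))
        + wt V q (insert e \<omega>) * (incr S (insert e \<omega>) a + incr S (insert e \<omega>) (opp a)))"
      using finE by (intro sum_Pow_insert) auto
    also have "\<dots> = 0"
      using eE q a by (intro sum.neutral ballI incr_pair[OF _ rec S _ _ e_def]) auto
    finally show ?thesis by simp
  qed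
  have bij: "bij_betw opp (D - ext) (D - ext)"
    by (rule bij_betw_byWitness[of _ opp]) (use opp_int in auto)
  have "(\<Sum>x\<in>D - ext. G x) = (\<Sum>x\<in>D - ext. G (opp x))"
    by (rule sum.reindex_bij_betw[OF bij, symmetric])
  also have "\<dots> = - (\<Sum>x\<in>D - ext. G x)" using anti by (simp add: sum_negf[symmetric])
  finally have "(\<Sum>x\<in>D - ext. G x) = 0" by simp
  moreover have "(\<Sum>x\<in>D. G x) = (\<Sum>x\<in>D - ext. G x) + (\<Sum>x\<in>ext. G x)"
    by (rule sum.subset_diff) (use finD in \<open>auto simp: ext_def\<close>)
  ultimately have 2: "(\<Sum>x\<in>ext. G x) = (S 4 - S 0) * Z" using 1 by simp
  have 3: "G x = c (winding E x) * pr V q E (\<lambda>\<omega>. connects \<omega> origin (fst x)) * Z" if x: "x \<in> ext" for x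
  proof -
    have i: "incr S \<omega> x = (if connects \<omega> origin (fst x) then c (winding E x) else 0)" if "\<omega> \<in> Pow E" for \<omega>
    proof -
      have w: "\<omega> \<subseteq> E" using that by simp
      have "turn \<omega> x = 1" using not_open_ext[OF w x] by (simp add: turn_def)
      then show ?thesis
        using turn_orb_r(2)[OF w x] winding_ext[OF w x] S by (simp add: incr_def)
    qed
    have "G x = (\<Sum>\<omega>\<in>Pow E. c (winding E x) * (if connects \<omega> origin (fst x) then wt V q \<omega> else 0))"
      unfolding G_def using i by (intro sum.cong) auto
    also have "\<dots> = c (winding E x) * (\<Sum>\<omega>\<in>Pow E. if connects \<omega> origin (fst x) then wt V q \<omega> else 0)"
      by (simp add: sum_distrib_left)
    also have "(\<Sum>\<omega>\<in>Pow E. if connects \<omega> origin (fst x) then wt V q \<omega> else 0)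
      = (\<Sum>\<omega>\<in>{\<omega>. \<omega> \<subseteq> E \<and> connects \<omega> origin (fst x)}. wt V q \<omega>)"
      using finE by (intro sum.mono_neutral_cong_right) auto
    finally show ?thesis using Z by (simp add: pr_def flip: Z_def)
  qed
  have "(\<Sum>x\<in>ext. c (winding E x) * pr V q E (\<lambda>\<omega>. connects \<omega> origin (fst x))) * Z = (S 4 - S 0) * Z"
    unfolding sum_distrib_right 2[symmetric] using 3 by (intro sum.cong) auto
  moreover have "S 4 - S 0 = c 0 + c 1 + c 2 + c 3" using S[of 0] S[of 1] S[of 2] S[of 3] by simp
  ultimately show ?thesis using Z by simp
qed

end

section \<open>The slit box\<close>

lemma per_dvd: assumes "periodic f x" "(f ^^ K) x = x" shows "per f x dvd K"
proof -
  have "(f ^^ (K mod per f x)) x = x"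
    using funpow_mod_eq[OF per_props(2)[OF assms(1)]] assms(2) by simp
  moreover have "K mod per f x < per f x" using per_props(1)[OF assms(1)] by simp
  ultimately have "K mod per f x = 0" using per_le[of "K mod per f x" f x] by linarith
  then show ?thesis by auto
qed

lemma sum_lessThan_add: "(\<Sum>l<j + k. g l) = (\<Sum>l<k. g l) + (\<Sum>l<j. g (l + k))" for j k :: nat
  by (induction j) (auto simp: add_ac)

lemma sum_multiple_per:
  fixes t :: "'a \<Rightarrow> int"
  assumes "periodic f x"
  shows "(\<Sum>l<a * per f x. t ((f ^^ l) x)) = int a * (\<Sum>l<per f x. t ((f ^^ l) x))"
proof (induction a)
  case (Suc a)
  let ?p = "per f x"
  have sh: "(f ^^ (l + a * ?p)) x = (f ^^ l) x" for l
    using periodic_multiple[OF per_props(2)[OF assms], of a] by (simp add: funpow_add)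
  have "(\<Sum>l<Suc a * ?p. t ((f ^^ l) x))
    = (\<Sum>l<a * ?p. t ((f ^^ l) x)) + (\<Sum>l<?p. t ((f ^^ (l + a * ?p)) x))"
    using sum_lessThan_add[of "\<lambda>l. t ((f ^^ l) x)" ?p "a * ?p"] by simp
  also have "\<dots> = (\<Sum>l<a * ?p. t ((f ^^ l) x)) + (\<Sum>l<?p. t ((f ^^ l) x))" unfolding sh ..
  finally show ?case using Suc by (simp add: algebra_simps)
qed simp

text \<open>The number of steps is deliberately forgotten and the walk may repeat darts; this lets
  walks be composed by adding turnings. \<open>travels_closed_tour\<close> later recovers the
  position within one period.\<close>

definition travels :: "vert set set \<Rightarrow> dart \<Rightarrow> int \<Rightarrow> dart \<Rightarrow> bool" where
  "travels \<omega> c w c' \<longleftrightarrow> (\<exists>k. (nxt \<omega> ^^ k) c = c' \<and> (\<Sum>l<k. turn \<omega> ((nxt \<omega> ^^ l) c)) = w)"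

lemma travels_refl: "travels \<omega> c 0 c"
  unfolding travels_def by (intro exI[of _ 0]) simp

lemma travels_step: "travels \<omega> c (turn \<omega> c) (nxt \<omega> c)"
  unfolding travels_def by (intro exI[of _ 1]) simp

lemma travels_trans:
  assumes "travels \<omega> c w c'" "travels \<omega> c' w' c''" shows "travels \<omega> c (w + w') c''"
proof -
  obtain k where k: "(nxt \<omega> ^^ k) c = c'" "(\<Sum>l<k. turn \<omega> ((nxt \<omega> ^^ l) c)) = w"
    using assms(1) by (auto simp: travels_def)
  obtain j where j: "(nxt \<omega> ^^ j) c' = c''" "(\<Sum>l<j. turn \<omega> ((nxt \<omega> ^^ l) c')) = w'"
    using assms(2) by (auto simp: travels_def)
  have "(nxt \<omega> ^^ (j + k)) c = c''" using k j by (simp add: funpow_add)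
  moreover have "(\<Sum>l<j + k. turn \<omega> ((nxt \<omega> ^^ l) c)) = w + w'"
    unfolding sum_lessThan_add using j k by (simp add: funpow_add)
  ultimately show ?thesis unfolding travels_def by blast
qed

lemma travels_closed: "\<not> is_open \<omega> (v, d) \<Longrightarrow> travels \<omega> (v, d) 1 (v, rot d)"
  using travels_step[of \<omega> "(v, d)"] by (simp add: turn_def nxt_def)

lemma travels_open: "is_open \<omega> (v, d) \<Longrightarrow> travels \<omega> (v, d) (-1) (v + d, irot d)"
  using travels_step[of \<omega> "(v, d)"] by (simp add: turn_def nxt_def)

lemma is_open_edges_in:
  "is_open (edges_in V) (v, d) \<longleftrightarrow> v \<in> V \<and> v + d \<in> V \<and> d \<in> dirs"
proof
  assume "is_open (edges_in V) (v, d)"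
  then obtain u w where uw: "{v, v + d} = {u, w}" "u \<in> V" "w \<in> V" "adjacent u w"
    unfolding is_open_def by (auto elim: edges_inE)
  then have "adjacent v (v + d)" by (auto simp: doubleton_eq_iff adjacent_def)
  then show "v \<in> V \<and> v + d \<in> V \<and> d \<in> dirs" using uw adjacent_dirs by (auto simp: doubleton_eq_iff)
next
  assume "v \<in> V \<and> v + d \<in> V \<and> d \<in> dirs"
  then show "is_open (edges_in V) (v, d)"
    using adjacent_dirs[of v d] unfolding is_open_def edges_in_def fst_conv snd_conv by blast
qed

text \<open>A straight piece of the boundary, with the outside in direction d.\<close>

lemma travels_wall:
  fixes i j m :: int and d v :: vert
  defines "pt \<equiv> \<lambda>i. (fst v + i * fst (rot d), snd v + i * snd (rot d))"
  assumes d: "d \<in> dirs" and V: "\<And>i. 0 \<le> i \<Longrightarrow> i \<le> m \<Longrightarrow> pt i \<in> V \<and> pt i + d \<notin> V"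
    and ij: "0 \<le> i" "i \<le> j" "j \<le> m"
  shows "travels (edges_in V) (pt i, d) 0 (pt j, d)"
  using ij(2,3)
proof (induction j rule: int_ge_induct)
  case (step j)
  have n: "pt j + rot d = pt (j + 1)" by (simp add: pt_def prod_eq_iff algebra_simps)
  have "travels (edges_in V) (pt j, d) 1 (pt j, rot d)"
    using V[of j] step ij by (intro travels_closed) (simp add: is_open_edges_in)
  moreover have "is_open (edges_in V) (pt j, rot d)"
    using V[of j] V[of "j + 1"] step ij d n by (simp add: is_open_edges_in)
  then have "travels (edges_in V) (pt j, rot d) (-1) (pt (j + 1), d)"
    using travels_open[of "edges_in V" "pt j" "rot d"] n by simp
  ultimately have "travels (edges_in V) (pt j, d) 0 (pt (j + 1), d)"
    using travels_trans by fastforce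
  then show ?case using travels_trans[of _ _ 0 _ 0] step by fastforce
qed (rule travels_refl)

fun angle :: "vert \<Rightarrow> int" where
  "angle (x, y) = (if x = 1 then 0 else if y = 1 then 1 else if x = -1 then 2 else 3)"

lemma angle_nxt:
  fixes c :: dart
  assumes "snd c \<in> dirs"
  shows "4 dvd angle (snd (nxt \<omega> c)) - angle (snd c) - turn \<omega> c" "snd (nxt \<omega> c) \<in> dirs"
  using assms by (auto simp: nxt_def turn_def dirs_def rot.simps irot.simps)

text \<open>Each step rotates the direction by a quarter turn of the recorded sign, and on return
  the direction is the initial one.\<close>

lemma sum_turn_closed:
  assumes "snd c \<in> dirs" "(nxt \<omega> ^^ k) c = c"
  shows "4 dvd (\<Sum>l<k. turn \<omega> ((nxt \<omega> ^^ l) c))"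
proof -
  have "snd ((nxt \<omega> ^^ k) c) \<in> dirs \<and>
    4 dvd angle (snd ((nxt \<omega> ^^ k) c)) - angle (snd c) - (\<Sum>l<k. turn \<omega> ((nxt \<omega> ^^ l) c))" for k
  proof (induction k)
    case (Suc k)
    let ?c = "(nxt \<omega> ^^ k) c"
    have "4 dvd (angle (snd (nxt \<omega> ?c)) - angle (snd ?c) - turn \<omega> ?c) +
      (angle (snd ?c) - angle (snd c) - (\<Sum>l<k. turn \<omega> ((nxt \<omega> ^^ l) c)))"
      using Suc angle_nxt[of ?c \<omega>] by (intro dvd_add) auto
    then show ?case using Suc angle_nxt(2)[of ?c \<omega>] by (simp add: algebra_simps)
  qed (use assms in simp)
  from this[of k] show ?thesis using assms by simp
qed

text \<open>A closed walk of turning 4 consists of whole periods, each with turning divisible by 4,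
  so it is exactly one period. This replaces checking that an explicit tour visits no dart twice. A
  dart on the way, from which the walk returns with the complementary turning, is thus met inside
  the first period.\<close>

lemma travels_closed_tour:
  assumes c: "snd c \<in> dirs" and tour: "travels \<omega> c 4 c"
  shows "periodic (nxt \<omega>) c" "sum (turn \<omega>) (orb (nxt \<omega>) c) = 4"
    and "travels \<omega> c w c' \<Longrightarrow> travels \<omega> c' (4 - w) c \<Longrightarrow> c' \<noteq> c \<Longrightarrow> lift (nxt \<omega>) (turn \<omega>) c c' = w"
proof -
  let ?f = "nxt \<omega>" and ?s = "\<lambda>k. \<Sum>l<k. turn \<omega> ((nxt \<omega> ^^ l) c)"
  have main: "periodic ?f c \<and> per ?f c = K \<and> ?s K = 4" if K: "(?f ^^ K) c = c" "?s K = 4" for K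
  proof -
    have "K > 0" using K(2) by (cases K) auto
    then have p: "periodic ?f c" using K by (auto simp: periodic_def)
    obtain a where a: "K = a * per ?f c" using per_dvd[OF p K(1)] by (metis dvd_def mult.commute)
    have "4 dvd ?s (per ?f c)" by (rule sum_turn_closed[OF c per_props(2)[OF p]])
    then obtain b where b: "?s (per ?f c) = 4 * b" by (auto simp: dvd_def)
    have "int a * (4 * b) = 4" using sum_multiple_per[OF p, of "turn \<omega>" a] K(2) a b by simp
    then have "int a * b = 1" by simp
    then have "a = 1" by (auto simp: zmult_eq_1_iff)
    then show ?thesis using p a K by simp
  qed
  obtain K where K: "(?f ^^ K) c = c" "?s K = 4" using tour by (auto simp: travels_def)
  show p: "periodic ?f c" using main[OF K] by simp
  show "sum (turn \<omega>) (orb ?f c) = 4" using sum_orb[OF inj_nxt p, of "turn \<omega>"] main[OF K] by simp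
  assume 1: "travels \<omega> c w c'" and 2: "travels \<omega> c' (4 - w) c" and ne: "c' \<noteq> c"
  obtain k where k: "(?f ^^ k) c = c'" "?s k = w" using 1 by (auto simp: travels_def)
  obtain j where j: "(?f ^^ j) c' = c" "(\<Sum>l<j. turn \<omega> ((?f ^^ l) c')) = 4 - w"
    using 2 by (auto simp: travels_def)
  have "(?f ^^ (j + k)) c = c" using k j by (simp add: funpow_add)
  moreover have "?s (j + k) = 4"
    unfolding sum_lessThan_add using j k by (simp add: funpow_add)
  ultimately have "per ?f c = j + k" using main by blast
  moreover have "j > 0" using j(1) ne by (cases j) auto
  ultimately have "k < per ?f c" by simp
  then show "lift ?f (turn \<omega>) c c' = w" using lift_funpow[OF inj_nxt, of k \<omega> c "turn \<omega>"] k by simp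
qed

section \<open>The slit box and its boundary tour\<close>

definition slit :: "nat \<Rightarrow> vert set" where
  "slit n = box n - {(0, y) | y. y < 0}"

definition box_boundary :: "nat \<Rightarrow> vert set" where
  "box_boundary n = {v \<in> box n. \<bar>fst v\<bar> = int n \<or> \<bar>snd v\<bar> = int n}"

lemma in_slit: "(x, y) \<in> slit n \<longleftrightarrow> \<bar>x\<bar> \<le> int n \<and> \<bar>y\<bar> \<le> int n \<and> \<not> (x = 0 \<and> y < 0)"
  by (auto simp: slit_def box_def)

lemma in_box_boundary: "(x, y) \<in> box_boundary n \<longleftrightarrow> \<bar>x\<bar> \<le> int n \<and> \<bar>y\<bar> \<le> int n \<and> (\<bar>x\<bar> = int n \<or> \<bar>y\<bar> = int n)"
  by (auto simp: box_boundary_def box_def)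

text \<open>From \<open>r\<close> the tour runs down the right side of the slit, counterclockwise
  around the box and up the left side of the slit; the seven straight sides have turning -2, -1, 0,
  1, 2, 3, 4. In the proof, \<open>w1\<close> to \<open>w7\<close> move along parts of a side,
  \<open>l1\<close> to \<open>l7\<close> along whole sides, \<open>c1\<close> to \<open>c7\<close>
  pass from a side to what follows; \<open>s0\<close> and \<open>a2\<close> to \<open>a7\<close>
  lead from \<open>r\<close> to the start of a side, \<open>b1\<close> to \<open>b7\<close> from its
  end back to \<open>r\<close>.\<close>

lemma slit_tour:
  assumes n: "n \<ge> 1"
  defines "T \<equiv> travels (edges_in (slit n))" and "r \<equiv> ((0, 0), (1, 0))"
  shows "T r 4 r" "T r 3 ((0, 0), (0, -1))"
    and "c \<in> slit n \<times> dirs \<Longrightarrow> fst c + snd c \<notin> slit n \<Longrightarrow> c \<noteq> ((0, 0), (0, -1)) \<Longrightarrow>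
      \<exists>w. T r w c \<and> T c (4 - w) r \<and> (w = -2 \<or> w = 4 \<or> fst c \<in> box_boundary n)"
proof -
  define N where "N = int n"
  have N: "N \<ge> 1" using n by (simp add: N_def)
  note S = in_slit N_def[symmetric] rot.simps irot.simps
  have w1: "T ((1, -1 - i), (-1, 0)) 0 ((1, -1 - j), (-1, 0))" if "0 \<le> i" "i \<le> j" "j \<le> N - 1" for i j
    using travels_wall[of "(-1, 0)" "N - 1" "(1, -1)" "slit n" i j] that N
    by (simp add: S T_def dirs_def)
  have w2: "T ((1 + i, - N), (0, -1)) 0 ((1 + j, - N), (0, -1))" if "0 \<le> i" "i \<le> j" "j \<le> N - 1" for i j
    using travels_wall[of "(0, -1)" "N - 1" "(1, - N)" "slit n" i j] that N
    by (simp add: S T_def dirs_def)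
  have w3: "T ((N, - N + i), (1, 0)) 0 ((N, - N + j), (1, 0))" if "0 \<le> i" "i \<le> j" "j \<le> 2 * N" for i j
    using travels_wall[of "(1, 0)" "2 * N" "(N, - N)" "slit n" i j] that N
    by (simp add: S T_def dirs_def)
  have w4: "T ((N - i, N), (0, 1)) 0 ((N - j, N), (0, 1))" if "0 \<le> i" "i \<le> j" "j \<le> 2 * N" for i j
    using travels_wall[of "(0, 1)" "2 * N" "(N, N)" "slit n" i j] that N
    by (simp add: S T_def dirs_def)
  have w5: "T ((- N, N - i), (-1, 0)) 0 ((- N, N - j), (-1, 0))" if "0 \<le> i" "i \<le> j" "j \<le> 2 * N" for i j
    using travels_wall[of "(-1, 0)" "2 * N" "(- N, N)" "slit n" i j] that N
    by (simp add: S T_def dirs_def)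
  have w6: "T ((- N + i, - N), (0, -1)) 0 ((- N + j, - N), (0, -1))" if "0 \<le> i" "i \<le> j" "j \<le> N - 1" for i j
    using travels_wall[of "(0, -1)" "N - 1" "(- N, - N)" "slit n" i j] that N
    by (simp add: S T_def dirs_def)
  have w7: "T ((-1, - N + i), (1, 0)) 0 ((-1, - N + j), (1, 0))" if "0 \<le> i" "i \<le> j" "j \<le> N - 1" for i j
    using travels_wall[of "(1, 0)" "N - 1" "(-1, - N)" "slit n" i j] that N
    by (simp add: S T_def dirs_def)
  have tr: "T c w c' \<Longrightarrow> T c' w' c'' \<Longrightarrow> w + w' = w'' \<Longrightarrow> T c w'' c''" for c c' c'' w w' w''
    unfolding T_def using travels_trans by blast
  have cl: "T ((x, y), (a, b)) 1 ((x, y), (- b, a))" if "(x + a, y + b) \<notin> slit n" for x y a b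
    using that travels_closed[of "edges_in (slit n)" "(x, y)" "(a, b)"]
    by (simp add: T_def is_open_edges_in rot.simps)
  have op: "T ((x, y), (a, b)) (-1) ((x + a, y + b), (b, - a))"
    if "(x, y) \<in> slit n" "(x + a, y + b) \<in> slit n" "(a, b) \<in> dirs" for x y a b
    using that travels_open[of "edges_in (slit n)" "(x, y)" "(a, b)"]
    by (simp add: T_def is_open_edges_in irot.simps)
  have s0: "T r (-2) ((1, -1), (-1, 0))"
  proof -
    have 1: "T r (-1) ((1, 0), (0, -1))" using op[of 0 0 1 0] N by (simp add: S dirs_def r_def)
    have 2: "T ((1, 0), (0, -1)) (-1) ((1, -1), (-1, 0))" using op[of 1 0 0 "-1"] N by (simp add: S dirs_def)
    from tr[OF 1 2] show ?thesis by simp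
  qed
  have c1: "T ((1, - N), (-1, 0)) 1 ((1, - N), (0, -1))" using cl[of 1 "-1" "- N" 0] N by (simp add: S)
  have c2: "T ((N, - N), (0, -1)) 1 ((N, - N), (1, 0))" using cl[of N 0 "- N" "-1"] N by (simp add: S)
  have c3: "T ((N, N), (1, 0)) 1 ((N, N), (0, 1))" using cl[of N 1 N 0] N by (simp add: S)
  have c4: "T ((- N, N), (0, 1)) 1 ((- N, N), (-1, 0))" using cl[of "- N" 0 N 1] N by (simp add: S)
  have c5: "T ((- N, - N), (-1, 0)) 1 ((- N, - N), (0, -1))" using cl[of "- N" "-1" "- N" 0] N by (simp add: S)
  have c6: "T ((-1, - N), (0, -1)) 1 ((-1, - N), (1, 0))" using cl[of "-1" 0 "- N" "-1"] N by (simp add: S)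
  have c7: "T ((-1, -1), (1, 0)) (-1) ((0, 0), (0, -1))"
  proof -
    have 1: "T ((-1, -1), (1, 0)) 1 ((-1, -1), (0, 1))" using cl[of "-1" 1 "-1" 0] N by (simp add: S)
    have 2: "T ((-1, -1), (0, 1)) (-1) ((-1, 0), (1, 0))" using op[of "-1" "-1" 0 1] N by (simp add: S dirs_def)
    have 3: "T ((-1, 0), (1, 0)) (-1) ((0, 0), (0, -1))" using op[of "-1" 0 1 0] N by (simp add: S dirs_def)
    have "T ((-1, -1), (1, 0)) 0 ((-1, 0), (1, 0))" by (rule tr[OF 1 2]) simp
    from tr[OF this 3] show ?thesis by simp
  qed
  have c8: "T ((0, 0), (0, -1)) 1 r" using cl[of 0 0 0 "-1"] N by (simp add: S r_def)
  have l1: "T ((1, -1), (-1, 0)) 0 ((1, - N), (-1, 0))" using w1[of 0 "N - 1"] N by simp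
  have l2: "T ((1, - N), (0, -1)) 0 ((N, - N), (0, -1))" using w2[of 0 "N - 1"] N by simp
  have l3: "T ((N, - N), (1, 0)) 0 ((N, N), (1, 0))" using w3[of 0 "2 * N"] N by simp
  have l4: "T ((N, N), (0, 1)) 0 ((- N, N), (0, 1))" using w4[of 0 "2 * N"] N by simp
  have l5: "T ((- N, N), (-1, 0)) 0 ((- N, - N), (-1, 0))" using w5[of 0 "2 * N"] N by simp
  have l6: "T ((- N, - N), (0, -1)) 0 ((-1, - N), (0, -1))" using w6[of 0 "N - 1"] N by simp
  have l7: "T ((-1, - N), (1, 0)) 0 ((-1, -1), (1, 0))" using w7[of 0 "N - 1"] N by simp
  have a2: "T r (-1) ((1, - N), (0, -1))" by (rule tr[OF tr[OF s0 l1 refl] c1]) simp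
  have a3: "T r 0 ((N, - N), (1, 0))" by (rule tr[OF tr[OF a2 l2 refl] c2]) simp
  have a4: "T r 1 ((N, N), (0, 1))" by (rule tr[OF tr[OF a3 l3 refl] c3]) simp
  have a5: "T r 2 ((- N, N), (-1, 0))" by (rule tr[OF tr[OF a4 l4 refl] c4]) simp
  have a6: "T r 3 ((- N, - N), (0, -1))" by (rule tr[OF tr[OF a5 l5 refl] c5]) simp
  have a7: "T r 4 ((-1, - N), (1, 0))" by (rule tr[OF tr[OF a6 l6 refl] c6]) simp
  show a8: "T r 3 ((0, 0), (0, -1))" by (rule tr[OF tr[OF a7 l7 refl] c7]) simp
  show "T r 4 r" by (rule tr[OF a8 c8]) simp
  have b7: "T ((-1, -1), (1, 0)) 0 r" by (rule tr[OF c7 c8]) simp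
  have b6: "T ((-1, - N), (0, -1)) 1 r" by (rule tr[OF tr[OF c6 l7 refl] b7]) simp
  have b5: "T ((- N, - N), (-1, 0)) 2 r" by (rule tr[OF tr[OF c5 l6 refl] b6]) simp
  have b4: "T ((- N, N), (0, 1)) 3 r" by (rule tr[OF tr[OF c4 l5 refl] b5]) simp
  have b3: "T ((N, N), (1, 0)) 4 r" by (rule tr[OF tr[OF c3 l4 refl] b4]) simp
  have b2: "T ((N, - N), (0, -1)) 5 r" by (rule tr[OF tr[OF c2 l3 refl] b3]) simp
  have b1: "T ((1, - N), (-1, 0)) 6 r" by (rule tr[OF tr[OF c1 l2 refl] b2]) simp
  assume c: "c \<in> slit n \<times> dirs" "fst c + snd c \<notin> slit n" "c \<noteq> ((0, 0), (0, -1))"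
  obtain x y a b where xy: "c = ((x, y), (a, b))" by (metis surj_pair)
  have xyS: "\<bar>x\<bar> \<le> N" "\<bar>y\<bar> \<le> N" "\<not> (x = 0 \<and> y < 0)" using c(1) by (auto simp: xy S)
  have ext: "\<bar>x + a\<bar> \<le> N \<and> \<bar>y + b\<bar> \<le> N \<Longrightarrow> x + a = 0 \<and> y + b < 0" using c(2) by (auto simp: xy S)
  have d: "(a, b) = (1, 0) \<or> (a, b) = (0, 1) \<or> (a, b) = (-1, 0) \<or> (a, b) = (0, -1)"
    using c(1) by (auto simp: xy dirs_def)
  have sph: "fst c \<in> box_boundary n" if "\<bar>x\<bar> = N \<or> \<bar>y\<bar> = N" using that xyS by (simp add: xy in_box_boundary N_def)
  consider (1) "x = 1" "(a, b) = (-1, 0)" "y \<le> -1" | (2) "y = - N" "(a, b) = (0, -1)" "x \<ge> 1"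
    | (3) "x = N" "(a, b) = (1, 0)" | (4) "y = N" "(a, b) = (0, 1)" | (5) "x = - N" "(a, b) = (-1, 0)"
    | (6) "y = - N" "(a, b) = (0, -1)" "x \<le> -1" | (7) "x = -1" "(a, b) = (1, 0)" "y \<le> -1"
    using d
  proof (elim disjE)
    assume "(a, b) = (1, 0)"
    then have "x = N \<or> (x = -1 \<and> y \<le> -1)" using ext xyS by (smt (verit) prod.inject)
    then show ?thesis using \<open>(a, b) = (1, 0)\<close> that(3,7) by blast
  next
    assume "(a, b) = (0, 1)"
    then have "y = N" using ext xyS by (smt (verit) prod.inject)
    then show ?thesis using \<open>(a, b) = (0, 1)\<close> that(4) by blast
  next
    assume "(a, b) = (-1, 0)"
    then have "x = - N \<or> (x = 1 \<and> y \<le> -1)" using ext xyS by (smt (verit) prod.inject)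
    then show ?thesis using \<open>(a, b) = (-1, 0)\<close> that(1,5) by blast
  next
    assume ab: "(a, b) = (0, -1)"
    then have "x \<noteq> 0 \<or> y \<noteq> 0" using c(3) by (auto simp: xy)
    then have "y = - N \<and> (x \<ge> 1 \<or> x \<le> -1)" using ext xyS ab N by (smt (verit) prod.inject)
    then show ?thesis using ab that(2,6) by blast
  qed
  then show "\<exists>w. T r w c \<and> T c (4 - w) r \<and> (w = -2 \<or> w = 4 \<or> fst c \<in> box_boundary n)"
  proof cases
    case 1
    have "T ((1, -1), (-1, 0)) 0 c" "T c 0 ((1, - N), (-1, 0))"
      using w1[of 0 "-1 - y"] w1[of "-1 - y" "N - 1"] 1 xyS N by (auto simp: xy)
    from tr[OF s0 this(1)] tr[OF this(2) b1] show ?thesis by (intro exI[of _ "-2"]) simp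
  next
    case 2
    have "T ((1, - N), (0, -1)) 0 c" "T c 0 ((N, - N), (0, -1))"
      using w2[of 0 "x - 1"] w2[of "x - 1" "N - 1"] 2 xyS N by (auto simp: xy)
    from tr[OF a2 this(1)] tr[OF this(2) b2] sph 2 N show ?thesis by (intro exI[of _ "-1"]) simp
  next
    case 3
    have "T ((N, - N), (1, 0)) 0 c" "T c 0 ((N, N), (1, 0))"
      using w3[of 0 "y + N"] w3[of "y + N" "2 * N"] 3 xyS N by (auto simp: xy)
    from tr[OF a3 this(1)] tr[OF this(2) b3] sph 3 N show ?thesis by (intro exI[of _ 0]) simp
  next
    case 4
    have "T ((N, N), (0, 1)) 0 c" "T c 0 ((- N, N), (0, 1))"
      using w4[of 0 "N - x"] w4[of "N - x" "2 * N"] 4 xyS N by (auto simp: xy)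
    from tr[OF a4 this(1)] tr[OF this(2) b4] sph 4 N show ?thesis by (intro exI[of _ 1]) simp
  next
    case 5
    have "T ((- N, N), (-1, 0)) 0 c" "T c 0 ((- N, - N), (-1, 0))"
      using w5[of 0 "N - y"] w5[of "N - y" "2 * N"] 5 xyS N by (auto simp: xy)
    from tr[OF a5 this(1)] tr[OF this(2) b5] sph 5 N show ?thesis by (intro exI[of _ 2]) simp
  next
    case 6
    have "T ((- N, - N), (0, -1)) 0 c" "T c 0 ((-1, - N), (0, -1))"
      using w6[of 0 "x + N"] w6[of "x + N" "N - 1"] 6 xyS N by (auto simp: xy)
    from tr[OF a6 this(1)] tr[OF this(2) b6] sph 6 N show ?thesis by (intro exI[of _ 3]) simp
  next
    case 7
    have "T ((-1, - N), (1, 0)) 0 c" "T c 0 ((-1, -1), (1, 0))"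
      using w7[of 0 "y + N"] w7[of "y + N" "N - 1"] 7 xyS N by (auto simp: xy)
    from tr[OF a7 this(1)] tr[OF this(2) b7] show ?thesis by (intro exI[of _ 4]) simp
  qed
qed

section \<open>Divergence of the sum\<close>

lemma connects_column:
  assumes V: "\<And>i. k \<le> i \<Longrightarrow> i \<le> j \<Longrightarrow> (x, i) \<in> V" and "k \<le> j"
  shows "connects (edges_in V) (x, k) (x, j)"
  using assms(2,1)
proof (induction j rule: int_ge_induct)
  case (step j)
  have "{(x, j), (x, j + 1)} \<in> edges_in V"
    using step.prems[of j] step.prems[of "j + 1"] step.hyps
    unfolding edges_in_def adjacent_def by fastforce
  then show ?case using step connects_edge connects_trans by fastforce
qed simp

lemma connects_row:
  assumes V: "\<And>i. k \<le> i \<Longrightarrow> i \<le> j \<Longrightarrow> (i, y) \<in> V" and "k \<le> j"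
  shows "connects (edges_in V) (k, y) (j, y)"
  using assms(2,1)
proof (induction j rule: int_ge_induct)
  case (step j)
  have "{(j, y), (j + 1, y)} \<in> edges_in V"
    using step.prems[of j] step.prems[of "j + 1"] step.hyps
    unfolding edges_in_def adjacent_def by fastforce
  then show ?case using step connects_edge connects_trans by fastforce
qed simp

text \<open>Each vertex is joined to the origin vertically and then along the row of the origin. The
  slit leaves this row intact, and in column 0 no vertex lies below it.\<close>

lemma slit_connected:
  assumes "u \<in> slit n" "v \<in> slit n" shows "connects (edges_in (slit n)) u v"
proof -
  have "connects (edges_in (slit n)) (0, 0) w" if w: "w \<in> slit n" for w
  proof -
    obtain x y where xy: "w = (x, y)" by (metis surj_pair)
    have S: "\<bar>x\<bar> \<le> int n" "\<bar>y\<bar> \<le> int n" "\<not> (x = 0 \<and> y < 0)" using w by (auto simp: xy in_slit)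
    have 1: "connects (edges_in (slit n)) (0, 0) (x, 0)"
    proof (cases "0 \<le> x")
      case True then show ?thesis using S by (intro connects_row) (auto simp: in_slit)
    next
      case False then show ?thesis
        using S by (intro connects_sym[OF connects_row]) (auto simp: in_slit)
    qed
    have "connects (edges_in (slit n)) (x, 0) (x, y)"
    proof (cases "0 \<le> y")
      case True then show ?thesis using S by (intro connects_column) (auto simp: in_slit)
    next
      case False then show ?thesis
        using S by (intro connects_sym[OF connects_column]) (auto simp: in_slit)
    qed
    with 1 show ?thesis unfolding xy by (rule connects_trans)
  qed
  from this[OF assms(1)] this[OF assms(2)] show ?thesis by (rule connects_trans[OF connects_sym])
qed

lemma finite_slit: "finite (slit n)"
  by (simp add: slit_def finite_box)

lemma slit_sc_domain: assumes "n \<ge> 1" shows "sc_domain (slit n) ((0, 0), (0, -1))"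
proof -
  let ?E = "edges_in (slit n)" and ?r = "((0, 0), (1, 0)) :: dart"
  have r: "(fst ((0, 0), (0, -1)), rot (snd ((0, 0), (0, -1)))) = ?r" by (simp add: rot.simps)
  have d: "snd ?r \<in> dirs" by (simp add: dirs_def)
  note T = travels_closed_tour[OF d slit_tour(1)[OF assms]]
  show ?thesis
  proof (unfold_locales, unfold r)
    show "sum (turn ?E) (orb (nxt ?E) ?r) = 4" by (rule T(2))
    fix c :: dart assume c: "c \<in> slit n \<times> dirs" "fst c + snd c \<notin> slit n"
    have "\<exists>w. travels ?E ?r w c"
      using slit_tour(2)[OF assms] slit_tour(3)[OF assms c] by (cases "c = ((0, 0), (0, -1))") auto
    then show "c \<in> orb (nxt ?E) ?r" unfolding travels_def by auto
  qed (use finite_slit slit_connected in \<open>auto simp: in_slit dirs_def\<close>)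
qed

lemma finite_box_boundary: "finite (box_boundary n)"
  using finite_box by (simp add: box_boundary_def)

lemma pr_nonneg: "q > 0 \<Longrightarrow> pr V q E A \<ge> 0"
  unfolding pr_def using less_imp_le[OF wt_pos] by (intro divide_nonneg_nonneg sum_nonneg) auto

text \<open>In the boundary identity the darts along the slit contribute nonpositively and those on
  the boundary of the box at most the connection probability, because c \<le> 1. The factor 4 bounds
  the number of boundary darts at one vertex.\<close>

lemma boundary_sum_ge:
  assumes q: "1 \<le> q" "q \<le> 3" and n: "n \<ge> 1"
  shows "1 \<le> 4 * (\<Sum>v\<in>box_boundary n. phi0_connect (p_crit q) q v)"
proof -
  interpret sc_domain "slit n" "((0, 0), (0, -1))" by (rule slit_sc_domain[OF n])
  have r: "r = ((0, 0), (1, 0))" by (simp add: r_def rot.simps)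
  have o: "origin = (0, 0)" by (simp add: origin_def)
  define \<psi> where "\<psi> = arccos (sqrt q / 2)"
  have sq: "sqrt q \<ge> 1" "sqrt q < 2" using q real_less_lsqrt[of 2 q] by auto
  have cs: "cos \<psi> = sqrt q / 2" unfolding \<psi>_def by (intro cos_arccos) (use sq in linarith)+
  define c :: "int \<Rightarrow> real" where "c w = cos (\<psi> * (real_of_int w - 1))" for w
  \<comment> \<open>A primitive of \<open>c\<close>: by the recurrence the second difference of
    \<open>c\<close> is (sqrt q - 2) c, and sqrt q < 2 makes the division possible.\<close>
  define S :: "int \<Rightarrow> real" where "S w = (c w - c (w - 1)) / (sqrt q - 2)" for w
  have rec: "c (w + 1) + c (w - 1) = sqrt q * c w" for w
  proof -
    have "c (w + 1) = cos (\<psi> * (real_of_int w - 1) + \<psi>)" "c (w - 1) = cos (\<psi> * (real_of_int w - 1) - \<psi>)"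
      unfolding c_def by (simp_all add: algebra_simps)
    then show ?thesis by (simp add: c_def cos_add cos_diff cs)
  qed
  have S: "S (w + 1) - S w = c w" for w
  proof -
    have "S (w + 1) - S w = (c (w + 1) + c (w - 1) - 2 * c w) / (sqrt q - 2)"
      by (simp add: S_def diff_divide_distrib add_divide_distrib)
    also have "\<dots> = (sqrt q - 2) * c w / (sqrt q - 2)" unfolding rec by (simp add: algebra_simps)
    finally show ?thesis using sq(2) by simp
  qed
  have c3: "c (-2) \<le> 0" "c 4 \<le> 0"
  proof -
    have "c 4 = cos (3 * \<psi>)" by (simp add: c_def mult.commute)
    also have "\<dots> = cos \<psi> * (4 * (cos \<psi>)\<^sup>2 - 3)"
      unfolding cos_treble_cos by (simp add: algebra_simps power2_eq_square power3_eq_cube)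
    also have "\<dots> = cos \<psi> * (q - 3)" using q by (simp add: cs power_divide)
    also have "\<dots> \<le> 0" using q by (simp add: cs mult_nonneg_nonpos)
    finally show "c 4 \<le> 0" .
    moreover have "c (-2) = c 4" unfolding c_def using cos_minus[of "\<psi> * 3"] by simp
    ultimately show "c (-2) \<le> 0" by simp
  qed
  have c012: "c 0 + c 1 + c 2 = 1 + sqrt q" by (simp add: c_def cs)
  have c1: "c w \<le> 1" for w by (simp add: c_def)
  have q0: "q > 0" using q by simp
  let ?P = "\<lambda>v. pr (slit n) q E (\<lambda>\<omega>. connects \<omega> (0, 0) v)"
  let ?r0 = "((0, 0), (0, -1)) :: dart"
  define \<Phi> where "\<Phi> v = phi0_connect (p_crit q) q v" for v
  have P: "0 \<le> ?P v" "?P v \<le> \<Phi> v" for v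
    using pr_nonneg[OF q0] phi0_connect_ge[OF q(1), of "slit n" n] unfolding \<Phi>_def E_def
    by (auto simp: slit_def)
  have d: "snd ((0, 0), (1, 0)) \<in> dirs" by (simp add: dirs_def)
  note T = travels_closed_tour(3)[OF d slit_tour(1)[OF n]]
  have wind: "winding E x = w"
    if "travels E ((0, 0), (1, 0)) w x" "travels E x (4 - w) ((0, 0), (1, 0))" "x \<noteq> ((0, 0), (1, 0))" for x w
    using T[of w x] that unfolding E_def r by blast
  \<comment> \<open>\<open>r0\<close> is the last dart of the orbit, so its winding is the total
    turning 4 minus its own left turn.\<close>
  have wr0: "winding E ?r0 = 3"
  proof -
    have "winding E ?r0 + turn E ?r0 = sum (turn E) (orb (nxt E) r)"
      by (rule lift_last[OF inj_nxt periodic_nxt[OF order_refl r_in] nxt_r0[OF order_refl] r0_in_orb[OF order_refl]])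
    then show ?thesis using turn_orb_r(1)[of E] not_open_ext[OF order_refl r0_ext] by (simp add: turn_def)
  qed
  have P0: "?P (0, 0) = 1"
  proof -
    have "(\<Sum>\<omega>\<in>Pow E. wt (slit n) q \<omega>) > 0" using finE q0 wt_pos by (intro sum_pos) auto
    then show ?thesis by (simp add: pr_def Pow_def)
  qed
  have fext: "finite ext" using finD by (simp add: ext_def)
  have "c 0 + c 1 + c 2 + c 3 = (\<Sum>x\<in>ext. c (winding E x) * ?P (fst x))"
    using boundary_identity[OF q0 rec S] by (simp add: o)
  also have "\<dots> = c 3 + (\<Sum>x\<in>ext - {?r0}. c (winding E x) * ?P (fst x))"
    using sum.remove[OF fext r0_ext, of "\<lambda>x. c (winding E x) * ?P (fst x)"] wr0 P0 by simp
  \<comment> \<open>The term of \<open>r0\<close> is exactly c(3) and cancels. What is left is c(1)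
    = 1 and c(0) + c(2) = 2 cos psi = sqrt q.\<close>
  finally have "1 + sqrt q = (\<Sum>x\<in>ext - {?r0}. c (winding E x) * ?P (fst x))" using c012 by simp
  also have "\<dots> \<le> (\<Sum>x\<in>ext - {?r0}. if fst x \<in> box_boundary n then \<Phi> (fst x) else 0)"
  proof (rule sum_mono)
    fix x assume x: "x \<in> ext - {?r0}"
    then have "x \<in> slit n \<times> dirs" "fst x + snd x \<notin> slit n" "x \<noteq> ?r0" by (auto simp: ext_def D_def)
    then obtain w where w: "travels E ((0, 0), (1, 0)) w x" "travels E x (4 - w) ((0, 0), (1, 0))"
      "w = -2 \<or> w = 4 \<or> fst x \<in> box_boundary n" using slit_tour(3)[OF n, of x] unfolding E_def by blast
    \<comment> \<open>The start of the tour has to be excluded, since its lift is 0 although the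
      closed tour also returns to it with turning 4. It points to an interior edge, as n \<ge>
      1.\<close>
    have "((0, 0), (1, 0)) \<notin> ext" using n by (simp add: ext_def in_slit)
    then have "x \<noteq> ((0, 0), (1, 0))" using x by auto
    then have wx: "winding E x = w" using wind w by blast
    show "c (winding E x) * ?P (fst x) \<le> (if fst x \<in> box_boundary n then \<Phi> (fst x) else 0)"
    proof (cases "fst x \<in> box_boundary n")
      case True
      have "c w * ?P (fst x) \<le> 1 * ?P (fst x)" using c1 P(1) by (rule mult_right_mono)
      then show ?thesis using True P(2)[of "fst x"] wx by simp
    next
      case False
      then have "c w \<le> 0" using w(3) c3 by auto
      then show ?thesis using False P(1) wx by (simp add: mult_nonpos_nonneg)
    qed
  qed
  also have "\<dots> = (\<Sum>x\<in>(ext - {?r0}) \<inter> {x. fst x \<in> box_boundary n}. \<Phi> (fst x))"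
    using fext by (simp add: sum.If_cases)
  also have "\<dots> \<le> (\<Sum>x\<in>box_boundary n \<times> dirs. \<Phi> (fst x))"
  proof (rule sum_mono2)
    show "finite (box_boundary n \<times> dirs)" using finite_box_boundary by simp
    show "0 \<le> \<Phi> (fst x)" for x :: dart using P[of "fst x"] by linarith
    show "(ext - {?r0}) \<inter> {x. fst x \<in> box_boundary n} \<subseteq> box_boundary n \<times> dirs"
      by (auto simp: ext_def D_def)
  qed
  also have "\<dots> = (\<Sum>v\<in>box_boundary n. \<Sum>d\<in>dirs. \<Phi> v)"
    by (subst sum.cartesian_product) (auto simp: case_prod_unfold)
  also have "\<dots> = 4 * (\<Sum>v\<in>box_boundary n. \<Phi> v)"
    by (simp add: card_dirs sum_distrib_left)
  finally show ?thesis using sq(1) unfolding \<Phi>_def by linarith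
qed

theorem theorem2:
  fixes q :: real
  assumes "1 \<le> q" and "q \<le> 3"
  shows "(\<Sum>\<^sub>\<infinity> x \<in> (UNIV :: vert set). ennreal (phi0_connect (p_crit q) q x)) = \<infinity>"
proof -
  let ?f = "phi0_connect (p_crit q) q"
  define X where "X = (\<Sum>\<^sub>\<infinity> x \<in> (UNIV :: vert set). ennreal (?f x))"
  \<comment> \<open>The empty domain suffices: its probability is nonnegative and bounds the limit
    from below.\<close>
  have f: "?f x \<ge> 0" for x
    using phi0_connect_ge[OF assms(1), of "{}" 0 x] pr_nonneg[of q "{}" "edges_in {}"] assms(1)
    by (meson empty_subsetI less_le_trans order_trans zero_less_one)
  have "ennreal (real N / 4) \<le> X" for N
  proof -
    define F where "F = (\<Union>n\<in>{1..N}. box_boundary n)"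
    have "real N / 4 = (\<Sum>n\<in>{1..N}. 1 / 4)" by simp
    also have "\<dots> \<le> (\<Sum>n\<in>{1..N}. sum ?f (box_boundary n))"
      using boundary_sum_ge[OF assms] by (intro sum_mono) (simp add: field_simps)
    \<comment> \<open>The boundaries are spheres of the sup norm with distinct radii, hence
      disjoint.\<close>
    also have "\<dots> = sum ?f F" unfolding F_def
      by (rule sum.UNION_disjoint[symmetric])
        (auto simp: finite_box_boundary in_box_boundary)
    finally have "ennreal (real N / 4) \<le> ennreal (sum ?f F)" by (rule ennreal_leI)
    also have "\<dots> = (\<Sum>x\<in>F. ennreal (?f x))" using f by (simp add: sum_ennreal)
    also have "\<dots> \<le> X" unfolding X_def
      by (subst nonneg_infsum_complete)
        (auto simp: F_def finite_box_boundary intro!: SUP_upper)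
    finally show ?thesis .
  qed
  have "X = top"
  proof (rule ccontr)
    assume "X \<noteq> top"
    then obtain x where x: "x \<ge> 0" "X = ennreal x" by (cases X) auto
    obtain N :: nat where "4 * x < real N" using reals_Archimedean2 by blast
    moreover have "real N / 4 \<le> x"
      using \<open>ennreal (real N / 4) \<le> X\<close> x by (simp add: ennreal_le_iff)
    ultimately show False by simp
  qed
  then show ?thesis by (simp add: X_def)
qed

end
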